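(* Let $M$ be a totally geodesic pointwise $k$-slant submanifold of a Kähler manifold $(\bar M,\varphi,g)$, with associated orthogonal decomposition $TM=\mathcal D_0\oplus\mathcal D_1\oplus\dots\oplus\mathcal D_k$ and slant functions $\theta_0=0,\theta_1,\dots,\theta_k$. Then: (i) $\mathcal D_0$ is an integrable distribution; (ii) for $i\in\{0,\dots,k\}$ with $\theta_j(p)\neq\frac{\pi}{2}$ for all $p\in M$ and all $j\neq i$, $j\in\{0,\dots,k\}$, $\mathcal D_i$ is an integrable distribution if and only if $$\nabla_XTY-\nabla_YTX\in\Gamma(\mathcal D_i)$$ for all $X,Y\in\Gamma(\mathcal D_i)$.
   Context: An almost Hermitian manifold $(\bar M,\varphi,g)$ is a Riemannian manifold $(\bar M,g)$ with a $(1,1)$-tensor field $\varphi$ such that $\varphi^2=-I$ and $g(\varphi\cdot,\varphi\cdot)=g$. Here it is called Kähler if $\bar\nabla\varphi=0$, where $\bar\nabla$ is the Levi-Civita connection of $g$. Let $M$ be a submanifold of $\bar M$ defined by an injective immersion, with induced metric also denoted $g$ and Levi-Civita connection $\nabla$. The second fundamental form $h$ is given by $\bar\nabla_XY=\nabla_XY+h(X,Y)$ for $X,Y\in\Gamma(TM)$; $M$ is totally geodesic if $h=0$. For $X\in\Gamma(TM)$ write $\varphi X=TX+NX$ with $TX$ tangent and $NX$ normal to $M$. A distribution $\mathcal D\subseteq TM$ is pointwise slant if, at each $p\in M$, the angle $\theta(p)$ between $\varphi X_p$ and $\mathcal D_p$ is nonzero and independent of the choice of $X_p\in\mathcal D_p\setminus\{0\}$;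 $\theta$ is its slant function. $M$ is a pointwise $k$-slant submanifold of $\bar M$ ($k\in\mathbb N$, $k\ge1$) if there exist mutually orthogonal smooth regular (constant rank) distributions $\mathcal D_0,\dots,\mathcal D_k$ on $M$ such that: $TM=\mathcal D_0\oplus\mathcal D_1\oplus\dots\oplus\mathcal D_k$; $T(\mathcal D_i)\subseteq\mathcal D_i$ for $i\in\{1,\dots,k\}$; $\mathcal D_0$ is invariant ($\varphi(\mathcal D_0)\subseteq\mathcal D_0$), possibly trivial; and $\mathcal D_1,\dots,\mathcal D_k$ are nontrivial pointwise slant distributions with slant functions $\theta_i(p)\in(0,\frac{\pi}{2}]$ that are pointwise distinct ($\theta_i(p)\ne\theta_j(p)$ for all $p\in M$ and $i\ne j$). By convention $\theta_0=0$. A distribution $\mathcal D$ is integrable if $[X,Y]\in\Gamma(\mathcal D)$ for all $X,Y\in\Gamma(\mathcal D)$. *)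

theory Defs
  imports "HOL-Analysis.Analysis" "HOL-Library.Function_Algebras"
begin

text \<open>Tangent vectors are families of coordinate representations indexed by the charts of an
  atlas (see \<open>tspace\<close> below), so function spaces have to carry the pointwise real vector space
  structure.\<close>

instantiation "fun" :: (type, real_vector) real_vector
begin

definition scaleR_fun_def: "a *\<^sub>R f = (\<lambda>x. a *\<^sub>R f x)"

instance
  by standard
    (simp_all add: scaleR_fun_def plus_fun_def fun_eq_iff scaleR_add_right scaleR_add_left)

end


section \<open>Smooth manifolds\<close>

text \<open>Both predicates are only meant for open sets \<open>S\<close>.\<close>

primrec Ck_on :: "nat \<Rightarrow> ('a::real_normed_vector \<Rightarrow> 'b::real_normed_vector) \<Rightarrow> 'a set \<Rightarrow> bool" where
  "Ck_on 0 f S = continuous_on S f"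
| "Ck_on (Suc k) f S =
    ((\<forall>x\<in>S. f differentiable (at x)) \<and> (\<forall>v. Ck_on k (\<lambda>x. frechet_derivative f (at x) v) S))"

definition smooth_on :: "('a::real_normed_vector \<Rightarrow> 'b::real_normed_vector) \<Rightarrow> 'a set \<Rightarrow> bool" where
  "smooth_on f S \<longleftrightarrow> (\<forall>k. Ck_on k f S)"

type_synonym ('m, 'e) chart = "'m set \<times> ('m \<Rightarrow> 'e)"
type_synonym ('m, 'e) atlas = "('m, 'e) chart set"
type_synonym ('m, 'e) tvec = "('m, 'e) chart \<Rightarrow> 'e"
type_synonym ('m, 'e) vfield = "'m \<Rightarrow> ('m, 'e) tvec"
type_synonym ('m, 'e) metric = "'m \<Rightarrow> ('m, 'e) tvec \<Rightarrow> ('m, 'e) tvec \<Rightarrow> real"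
type_synonym ('m, 'e) endo = "'m \<Rightarrow> ('m, 'e) tvec \<Rightarrow> ('m, 'e) tvec"
type_synonym ('m, 'e) connection = "('m, 'e) vfield \<Rightarrow> ('m, 'e) vfield \<Rightarrow> ('m, 'e) vfield"
type_synonym ('m, 'e) distribution = "'m \<Rightarrow> ('m, 'e) tvec set"

abbreviation cdom :: "('m, 'e) chart \<Rightarrow> 'm set" where "cdom c \<equiv> fst c"
abbreviation cmap :: "('m, 'e) chart \<Rightarrow> 'm \<Rightarrow> 'e" where "cmap c \<equiv> snd c"
abbreviation cinv :: "('m, 'e) chart \<Rightarrow> 'e \<Rightarrow> 'm" where "cinv c \<equiv> inv_into (cdom c) (cmap c)"

text \<open>The underlying set of the manifold is the whole type \<open>'m\<close>. The atlas need not be maximal.\<close>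

definition smooth_atlas ::
    "('m::{t2_space,second_countable_topology}, 'e::euclidean_space) atlas \<Rightarrow> bool" where
  "smooth_atlas A \<longleftrightarrow>
     (\<forall>c\<in>A. open (cdom c) \<and> open (cmap c ` cdom c) \<and>
        homeomorphism (cdom c) (cmap c ` cdom c) (cmap c) (cinv c)) \<and>
     (\<Union>c\<in>A. cdom c) = UNIV \<and>
     (\<forall>c\<in>A. \<forall>d\<in>A. smooth_on (cmap d \<circ> cinv c) (cmap c ` (cdom c \<inter> cdom d)))"

definition smooth_fun ::
    "('m, 'e::euclidean_space) atlas \<Rightarrow> 'm set \<Rightarrow> ('m \<Rightarrow> 'v::real_normed_vector) \<Rightarrow> bool" where
  "smooth_fun A U f \<longleftrightarrow> (\<forall>c\<in>A. smooth_on (f \<circ> cinv c) (cmap c ` (cdom c \<inter> U)))"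

definition smooth_map ::
    "('m::topological_space, 'e::euclidean_space) atlas \<Rightarrow>
     ('n::topological_space, 'f::euclidean_space) atlas \<Rightarrow> ('m \<Rightarrow> 'n) \<Rightarrow> bool" where
  "smooth_map A B F \<longleftrightarrow> continuous_on UNIV F \<and>
     (\<forall>c\<in>A. \<forall>d\<in>B. smooth_on (cmap d \<circ> F \<circ> cinv c) (cmap c ` (cdom c \<inter> F -` cdom d)))"

text \<open>A tangent vector at \<open>p\<close> assigns to every chart around \<open>p\<close> its vector of components, subject
  to the usual transformation law. The value 0 at all other charts makes tangent vectors with the
  same components equal.\<close>

definition tspace :: "('m, 'e::euclidean_space) atlas \<Rightarrow> 'm \<Rightarrow> ('m, 'e) tvec set" where
  "tspace A p = {v.
     (\<forall>c. \<not> (c \<in> A \<and> p \<in> cdom c) \<longrightarrow> v c = 0) \<and>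
     (\<forall>c\<in>A. \<forall>d\<in>A. p \<in> cdom c \<longrightarrow> p \<in> cdom d \<longrightarrow>
        v d = frechet_derivative (cmap d \<circ> cinv c) (at (cmap c p)) (v c))}"

definition chart_at :: "('m, 'e) atlas \<Rightarrow> 'm \<Rightarrow> ('m, 'e) chart" where
  "chart_at A p = (SOME c. c \<in> A \<and> p \<in> cdom c)"

text \<open>The derivative \<open>v(f)\<close> of a function along a tangent vector at \<open>p\<close>; it does not depend on the
  chart.\<close>

definition dirderiv ::
    "('m, 'e::euclidean_space) atlas \<Rightarrow> 'm \<Rightarrow> ('m, 'e) tvec \<Rightarrow> ('m \<Rightarrow> 'v::real_normed_vector) \<Rightarrow> 'v"
  where
  "dirderiv A p v f =
     (let c = chart_at A p in frechet_derivative (f \<circ> cinv c) (at (cmap c p)) (v c))"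

definition differential ::
    "('m, 'e::euclidean_space) atlas \<Rightarrow> ('n, 'f::euclidean_space) atlas \<Rightarrow> ('m \<Rightarrow> 'n) \<Rightarrow>
     'm \<Rightarrow> ('m, 'e) tvec \<Rightarrow> ('n, 'f) tvec" where
  "differential A B F p v =
     (\<lambda>d. if d \<in> B \<and> F p \<in> cdom d then dirderiv A p v (cmap d \<circ> F) else 0)"

definition smooth_vf ::
    "('m, 'e::euclidean_space) atlas \<Rightarrow> 'm set \<Rightarrow> ('m, 'e) vfield \<Rightarrow> bool" where
  "smooth_vf A U X \<longleftrightarrow> (\<forall>p\<in>U. X p \<in> tspace A p) \<and>
     (\<forall>c\<in>A. smooth_on (\<lambda>x. X (cinv c x) c) (cmap c ` (cdom c \<inter> U)))"

text \<open>In every chart, \<open>[X,Y]\<^sup>i = X(Y\<^sup>i) - Y(X\<^sup>i)\<close>.\<close>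

definition lie_bracket ::
    "('m, 'e::euclidean_space) atlas \<Rightarrow> ('m, 'e) vfield \<Rightarrow> ('m, 'e) vfield \<Rightarrow> ('m, 'e) vfield" where
  "lie_bracket A X Y p =
     (\<lambda>c. if c \<in> A \<and> p \<in> cdom c
          then dirderiv A p (X p) (\<lambda>q. Y q c) - dirderiv A p (Y p) (\<lambda>q. X q c) else 0)"


section \<open>Riemannian metrics and connections\<close>

definition riemannian_metric ::
    "('m::topological_space, 'e::euclidean_space) atlas \<Rightarrow> ('m, 'e) metric \<Rightarrow> bool" where
  "riemannian_metric A g \<longleftrightarrow>
     (\<forall>p. \<forall>u\<in>tspace A p. \<forall>v\<in>tspace A p. \<forall>w\<in>tspace A p. \<forall>a.
        g p (a *\<^sub>R u + v) w = a * g p u w + g p v w) \<and>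
     (\<forall>p. \<forall>u\<in>tspace A p. \<forall>v\<in>tspace A p. g p u v = g p v u) \<and>
     (\<forall>p. \<forall>u\<in>tspace A p. u \<noteq> 0 \<longrightarrow> 0 < g p u u) \<and>
     (\<forall>U X Y. open U \<longrightarrow> smooth_vf A U X \<longrightarrow> smooth_vf A U Y \<longrightarrow>
        smooth_fun A U (\<lambda>p. g p (X p) (Y p)))"

text \<open>An affine connection, acting on vector fields over arbitrary open sets \<open>U\<close>. Vector fields are
  total functions, but only their values on \<open>U\<close> matter: applying the Leibniz rule and
  \<open>C\<^sup>\<infinity>(U)\<close>-linearity to the indicator function of the complement of \<open>U\<close> shows that on \<open>U\<close> the field
  \<open>nabla X Y\<close> depends only on \<open>X\<close> and \<open>Y\<close> over \<open>U\<close>.\<close>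

definition affine_connection ::
    "('m::topological_space, 'e::euclidean_space) atlas \<Rightarrow> ('m, 'e) connection \<Rightarrow> bool" where
  "affine_connection A nabla \<longleftrightarrow> (\<forall>U. open U \<longrightarrow>
     (\<forall>X Y. smooth_vf A U X \<longrightarrow> smooth_vf A U Y \<longrightarrow> smooth_vf A U (nabla X Y)) \<and>
     (\<forall>X X' Y. smooth_vf A U X \<longrightarrow> smooth_vf A U X' \<longrightarrow> smooth_vf A U Y \<longrightarrow>
        (\<forall>p\<in>U. nabla (\<lambda>q. X q + X' q) Y p = nabla X Y p + nabla X' Y p)) \<and>
     (\<forall>f X Y. smooth_fun A U (f :: 'm \<Rightarrow> real) \<longrightarrow> smooth_vf A U X \<longrightarrow> smooth_vf A U Y \<longrightarrow>
        (\<forall>p\<in>U. nabla (\<lambda>q. f q *\<^sub>R X q) Y p = f p *\<^sub>R nabla X Y p)) \<and>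
     (\<forall>X Y Y'. smooth_vf A U X \<longrightarrow> smooth_vf A U Y \<longrightarrow> smooth_vf A U Y' \<longrightarrow>
        (\<forall>p\<in>U. nabla X (\<lambda>q. Y q + Y' q) p = nabla X Y p + nabla X Y' p)) \<and>
     (\<forall>f X Y. smooth_fun A U (f :: 'm \<Rightarrow> real) \<longrightarrow> smooth_vf A U X \<longrightarrow> smooth_vf A U Y \<longrightarrow>
        (\<forall>p\<in>U. nabla X (\<lambda>q. f q *\<^sub>R Y q) p =
           dirderiv A p (X p) f *\<^sub>R Y p + f p *\<^sub>R nabla X Y p)))"

definition levi_civita ::
    "('m::topological_space, 'e::euclidean_space) atlas \<Rightarrow> ('m, 'e) metric \<Rightarrow>
     ('m, 'e) connection \<Rightarrow> bool" where
  "levi_civita A g nabla \<longleftrightarrow> affine_connection A nabla \<and>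
     (\<forall>U X Y. open U \<longrightarrow> smooth_vf A U X \<longrightarrow> smooth_vf A U Y \<longrightarrow>
        (\<forall>p\<in>U. nabla X Y p - nabla Y X p = lie_bracket A X Y p)) \<and>
     (\<forall>U X Y Z. open U \<longrightarrow> smooth_vf A U X \<longrightarrow> smooth_vf A U Y \<longrightarrow> smooth_vf A U Z \<longrightarrow>
        (\<forall>p\<in>U. dirderiv A p (X p) (\<lambda>q. g q (Y q) (Z q)) =
           g p (nabla X Y p) (Z p) + g p (Y p) (nabla X Z p)))"


section \<open>Kaehler manifolds\<close>

definition almost_hermitian ::
    "('m::topological_space, 'e::euclidean_space) atlas \<Rightarrow> ('m, 'e) endo \<Rightarrow> ('m, 'e) metric \<Rightarrow> bool"
  where
  "almost_hermitian A \<phi> g \<longleftrightarrow> riemannian_metric A g \<and>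
     (\<forall>p. \<forall>v\<in>tspace A p. \<phi> p v \<in> tspace A p) \<and>
     (\<forall>p. \<forall>u\<in>tspace A p. \<forall>v\<in>tspace A p. \<forall>a. \<phi> p (a *\<^sub>R u + v) = a *\<^sub>R \<phi> p u + \<phi> p v) \<and>
     (\<forall>U X. open U \<longrightarrow> smooth_vf A U X \<longrightarrow> smooth_vf A U (\<lambda>p. \<phi> p (X p))) \<and>
     (\<forall>p. \<forall>v\<in>tspace A p. \<phi> p (\<phi> p v) = - v) \<and>
     (\<forall>p. \<forall>u\<in>tspace A p. \<forall>v\<in>tspace A p. g p (\<phi> p u) (\<phi> p v) = g p u v)"

text \<open>\<open>nabla\<close> is the Levi-Civita connection of \<open>g\<close>, and the last conjunct says that
  \<open>(nabla\<^sub>X \<phi>) Y = nabla\<^sub>X (\<phi> Y) - \<phi> (nabla\<^sub>X Y)\<close> vanishes.\<close>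

definition kaehler ::
    "('m::topological_space, 'e::euclidean_space) atlas \<Rightarrow> ('m, 'e) endo \<Rightarrow> ('m, 'e) metric \<Rightarrow>
     ('m, 'e) connection \<Rightarrow> bool" where
  "kaehler A \<phi> g nabla \<longleftrightarrow> almost_hermitian A \<phi> g \<and> levi_civita A g nabla \<and>
     (\<forall>U X Y. open U \<longrightarrow> smooth_vf A U X \<longrightarrow> smooth_vf A U Y \<longrightarrow>
        (\<forall>p\<in>U. nabla X (\<lambda>q. \<phi> q (Y q)) p - \<phi> p (nabla X Y p) = 0))"


section \<open>Submanifolds and the second fundamental form\<close>

definition injective_immersion ::
    "('m::topological_space, 'e::euclidean_space) atlas \<Rightarrow>
     ('n::topological_space, 'f::euclidean_space) atlas \<Rightarrow> ('m \<Rightarrow> 'n) \<Rightarrow> bool" where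
  "injective_immersion A B F \<longleftrightarrow>
     smooth_map A B F \<and> inj F \<and> (\<forall>p. inj_on (differential A B F p) (tspace A p))"

definition induced_metric ::
    "('m, 'e::euclidean_space) atlas \<Rightarrow> ('n, 'f::euclidean_space) atlas \<Rightarrow> ('m \<Rightarrow> 'n) \<Rightarrow>
     ('n, 'f) metric \<Rightarrow> ('m, 'e) metric" where
  "induced_metric A B F g p u v = g (F p) (differential A B F p u) (differential A B F p v)"

text \<open>The local vector field on the domain of \<open>c\<close> whose components in the chart \<open>c\<close> are constantly
  \<open>w\<close>.\<close>

definition coord_field ::
    "('m, 'e::euclidean_space) atlas \<Rightarrow> ('m, 'e) chart \<Rightarrow> 'e \<Rightarrow> ('m, 'e) vfield" where
  "coord_field A c w q =
     (\<lambda>d. if d \<in> A \<and> q \<in> cdom d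
          then frechet_derivative (cmap d \<circ> cinv c) (at (cmap c q)) w else 0)"

text \<open>If \<open>p\<close> lies in the domain of \<open>c\<close>, this is \<open>v\<^sup>i w\<^sup>j \<Gamma>\<^sup>k\<^sub>i\<^sub>j(p)\<close>, the term given by the Christoffel
  symbols of \<open>nabla\<close> with respect to the chart \<open>c\<close>.\<close>

definition christoffel ::
    "('m, 'e::euclidean_space) atlas \<Rightarrow> ('m, 'e) connection \<Rightarrow> ('m, 'e) chart \<Rightarrow> 'm \<Rightarrow>
     'e \<Rightarrow> 'e \<Rightarrow> 'e" where
  "christoffel A nabla c p v w = nabla (coord_field A c v) (coord_field A c w) p c"

text \<open>\<open>nabla\<^sub>v V\<close> for \<open>v\<close> tangent to the submanifold at \<open>p\<close> and \<open>V\<close> a vector field along \<open>F\<close> (that is,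
  \<open>V q\<close> is tangent to the ambient manifold at \<open>F q\<close>), where \<open>nabla\<close> is a connection of the ambient
  manifold. In components \<open>(nabla\<^sub>v V)\<^sup>k = v(V\<^sup>k) + \<Gamma>\<^sup>k\<^sub>i\<^sub>j (dF v)\<^sup>i V\<^sup>j\<close>. If \<open>V\<close> extends near \<open>F p\<close> to a
  vector field \<open>Z\<close> of the ambient manifold, that is \<open>V = Z \<circ> F\<close> near \<open>p\<close>, then this is \<open>nabla\<^bsub>dF v\<^esub> Z\<close>
  at \<open>F p\<close>.\<close>

definition cov_along ::
    "('m, 'e::euclidean_space) atlas \<Rightarrow> ('n, 'f::euclidean_space) atlas \<Rightarrow> ('m \<Rightarrow> 'n) \<Rightarrow>
     ('n, 'f) connection \<Rightarrow> 'm \<Rightarrow> ('m, 'e) tvec \<Rightarrow> ('m \<Rightarrow> ('n, 'f) tvec) \<Rightarrow> ('n, 'f) tvec" where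
  "cov_along A B F nabla p v V =
     (\<lambda>d. if d \<in> B \<and> F p \<in> cdom d
          then dirderiv A p v (\<lambda>q. V q d) +
               christoffel B nabla d (F p) (differential A B F p v d) (V p d)
          else 0)"

definition second_fundamental_form ::
    "('m, 'e::euclidean_space) atlas \<Rightarrow> ('n, 'f::euclidean_space) atlas \<Rightarrow> ('m \<Rightarrow> 'n) \<Rightarrow>
     ('n, 'f) connection \<Rightarrow> ('m, 'e) connection \<Rightarrow>
     ('m, 'e) vfield \<Rightarrow> ('m, 'e) vfield \<Rightarrow> 'm \<Rightarrow> ('n, 'f) tvec" where
  "second_fundamental_form A B F nablab nabla X Y p =
     cov_along A B F nablab p (X p) (\<lambda>q. differential A B F q (Y q)) -
     differential A B F p (nabla X Y p)"

definition totally_geodesic ::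
    "('m, 'e::euclidean_space) atlas \<Rightarrow> ('n, 'f::euclidean_space) atlas \<Rightarrow> ('m \<Rightarrow> 'n) \<Rightarrow>
     ('n, 'f) connection \<Rightarrow> ('m, 'e) connection \<Rightarrow> bool" where
  "totally_geodesic A B F nablab nabla \<longleftrightarrow>
     (\<forall>X Y p. smooth_vf A UNIV X \<longrightarrow> smooth_vf A UNIV Y \<longrightarrow>
        second_fundamental_form A B F nablab nabla X Y p = 0)"

text \<open>\<open>T v\<close> is the tangent vector \<open>w\<close> of the submanifold for which \<open>\<phi> (dF v) - dF w\<close> is normal to
  the submanifold.\<close>

definition tan_part ::
    "('m, 'e::euclidean_space) atlas \<Rightarrow> ('n, 'f::euclidean_space) atlas \<Rightarrow> ('m \<Rightarrow> 'n) \<Rightarrow>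
     ('n, 'f) endo \<Rightarrow> ('n, 'f) metric \<Rightarrow> ('m, 'e) endo" where
  "tan_part A B F \<phi> g p v =
     (THE w. w \<in> tspace A p \<and>
        (\<forall>z\<in>tspace A p. g (F p) (\<phi> (F p) (differential A B F p v) - differential A B F p w)
           (differential A B F p z) = 0))"


section \<open>Distributions and pointwise slant submanifolds\<close>

text \<open>Subbundles of the tangent bundle of constant rank \<open>r\<close>, given by smooth local frames.\<close>

definition regular_distribution ::
    "('m::topological_space, 'e::euclidean_space) atlas \<Rightarrow> ('m, 'e) distribution \<Rightarrow> bool" where
  "regular_distribution A D \<longleftrightarrow>
     (\<exists>r::nat. \<forall>p. \<exists>U E. open U \<and> p \<in> U \<and> (\<forall>i<r. smooth_vf A U (E i)) \<and>
        (\<forall>q\<in>U. inj_on (\<lambda>i. E i q) {..<r} \<and> independent ((\<lambda>i. E i q) ` {..<r}) \<and>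
           span ((\<lambda>i. E i q) ` {..<r}) = D q))"

definition sections ::
    "('m, 'e::euclidean_space) atlas \<Rightarrow> ('m, 'e) distribution \<Rightarrow> ('m, 'e) vfield set" where
  "sections A D = {X. smooth_vf A UNIV X \<and> (\<forall>p. X p \<in> D p)}"

definition integrable_distribution ::
    "('m, 'e::euclidean_space) atlas \<Rightarrow> ('m, 'e) distribution \<Rightarrow> bool" where
  "integrable_distribution A D \<longleftrightarrow>
     (\<forall>X\<in>sections A D. \<forall>Y\<in>sections A D. lie_bracket A X Y \<in> sections A D)"

definition orth_proj ::
    "('n, 'f) metric \<Rightarrow> 'n \<Rightarrow> ('n, 'f::euclidean_space) tvec set \<Rightarrow> ('n, 'f) tvec \<Rightarrow> ('n, 'f) tvec"
  where
  "orth_proj g p W u = (THE w. w \<in> W \<and> (\<forall>z\<in>W. g p (u - w) z = 0))"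

text \<open>The angle in \<open>[0, \<pi>/2]\<close> between a nonzero vector and a subspace of the tangent space.\<close>

definition angle_subspace ::
    "('n, 'f) metric \<Rightarrow> 'n \<Rightarrow> ('n, 'f::euclidean_space) tvec \<Rightarrow> ('n, 'f) tvec set \<Rightarrow> real" where
  "angle_subspace g p u W =
     arccos (sqrt (g p (orth_proj g p W u) (orth_proj g p W u)) / sqrt (g p u u))"

definition pointwise_slant ::
    "('m, 'e::euclidean_space) atlas \<Rightarrow> ('n, 'f::euclidean_space) atlas \<Rightarrow> ('m \<Rightarrow> 'n) \<Rightarrow>
     ('n, 'f) endo \<Rightarrow> ('n, 'f) metric \<Rightarrow> ('m, 'e) distribution \<Rightarrow> ('m \<Rightarrow> real) \<Rightarrow> bool" where
  "pointwise_slant A B F \<phi> g D \<theta> \<longleftrightarrow>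
     (\<forall>p. \<theta> p \<noteq> 0 \<and>
        (\<forall>v\<in>D p - {0}. angle_subspace g (F p) (\<phi> (F p) (differential A B F p v))
           (differential A B F p ` D p) = \<theta> p))"

definition pointwise_k_slant ::
    "('m::topological_space, 'e::euclidean_space) atlas \<Rightarrow>
     ('n::topological_space, 'f::euclidean_space) atlas \<Rightarrow> ('m \<Rightarrow> 'n) \<Rightarrow>
     ('n, 'f) endo \<Rightarrow> ('n, 'f) metric \<Rightarrow> nat \<Rightarrow>
     (nat \<Rightarrow> ('m, 'e) distribution) \<Rightarrow> (nat \<Rightarrow> 'm \<Rightarrow> real) \<Rightarrow> bool" where
  "pointwise_k_slant A B F \<phi> g k D \<theta> \<longleftrightarrow> 1 \<le> k \<and>
     (\<forall>i\<le>k. regular_distribution A (D i)) \<and>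
     (\<forall>i\<le>k. \<forall>j\<le>k. i \<noteq> j \<longrightarrow>
        (\<forall>p. \<forall>u\<in>D i p. \<forall>v\<in>D j p. induced_metric A B F g p u v = 0)) \<and>
     (\<forall>p. tspace A p = span (\<Union>i\<le>k. D i p)) \<and>
     (\<forall>i\<in>{1..k}. \<forall>p. \<forall>v\<in>D i p. tan_part A B F \<phi> g p v \<in> D i p) \<and>
     (\<forall>p. \<phi> (F p) ` differential A B F p ` D 0 p \<subseteq> differential A B F p ` D 0 p) \<and>
     (\<forall>i\<in>{1..k}. (\<forall>p. D i p \<noteq> {0}) \<and> pointwise_slant A B F \<phi> g (D i) (\<theta> i) \<and>
        (\<forall>p. 0 < \<theta> i p \<and> \<theta> i p \<le> pi / 2)) \<and>
     (\<forall>i\<in>{1..k}. \<forall>j\<in>{1..k}. i \<noteq> j \<longrightarrow> (\<forall>p. \<theta> i p \<noteq> \<theta> j p)) \<and>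
     (\<forall>p. \<theta> 0 p = 0)"

end

theory Submission
  imports Defs
begin

text \<open>The 2-form \<open>g (\<phi> u) v\<close> of a Kaehler manifold is parallel, and its pullback \<open>\<omega>\<close> to a
  totally geodesic submanifold is parallel as well. As \<open>\<omega>\<close> is \<open>T\<close> with one index lowered by the
  induced metric, this gives \<open>\<nabla>\<^sub>X (T Y) = T (\<nabla>\<^sub>X Y)\<close>. On \<open>D\<^sub>i\<close> the skew-adjoint operator \<open>T\<close> scales
  lengths by \<open>cos \<theta>\<^sub>i\<close>, so \<open>D\<^sub>0\<close> is the kernel of \<open>T\<^sup>2 + 1\<close> and is preserved by \<open>\<nabla>\<close>. For the second
  part, \<open>T [X,Y] = \<nabla>\<^sub>X (T Y) - \<nabla>\<^sub>Y (T X)\<close>, and \<open>T\<close> is injective on every \<open>D\<^sub>j\<close> with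
  \<open>\<theta>\<^sub>j \<noteq> \<pi>/2\<close>. Being totally geodesic only constrains global vector fields, so tangent vectors have
  to be extended by bump functions, and \<open>T Y\<close> has to be shown smooth.\<close>

section \<open>Smooth maps between Euclidean spaces\<close>

text \<open>Differentiating the decomposition of \<open>\<phi> (dF Y)\<close> into its tangent and
  normal parts would bring in a connection on the normal bundle. The 2-form avoids this: paired with
  a tangent vector the normal part vanishes, so \<open>h (T Y) Z = \<omega> Y Z\<close>, and both
  sides can be differentiated on the submanifold alone. The price is a product rule for ambient
  forms along \<open>F\<close>: \<open>dF Y\<close> is a field along \<open>F\<close> and not an
  ambient vector field, so it is expanded in ambient coordinate fields whose coefficients are
  functions on the submanifold. The algebra at a point needs only the quadratic identity
  \<open>h (T v) (T v) = (cos \<theta>\<^sub>i)\<^sup>2 * h v v\<close> and skewness. Testing a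
  vector against its own components makes it unnecessary to compute \<open>T\<^sup>2\<close> on each
  summand: a nonzero component in \<open>D\<^sub>j\<close> forces a value of
  \<open>cos \<theta>\<^sub>j\<close>, which the range of \<open>\<theta>\<^sub>j\<close> then
  excludes.\<close>

lemma frechet_derivative_eq:
  "(f has_derivative f') (at x) \<Longrightarrow> frechet_derivative f (at x) = f'"
  by (metis frechet_derivative_at)

text \<open>No differentiability is assumed: \<open>frechet_derivative\<close> chooses among all
  derivatives, and locally equal functions have the same ones, so the choice agrees as well.\<close>

lemma frechet_derivative_cong_open:
  assumes "open S" "x \<in> S" "\<And>y. y \<in> S \<Longrightarrow> f y = g y"
  shows "frechet_derivative f (at x) = frechet_derivative g (at x)"
proof -
  have "(f has_derivative D) (at x) \<longleftrightarrow> (g has_derivative D) (at x)" for D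
    using assms has_derivative_transform_within_open[of f D x UNIV S g]
      has_derivative_transform_within_open[of g D x UNIV S f] by auto
  then show ?thesis by (simp add: frechet_derivative_def)
qed

lemma differentiable_cong_open:
  assumes "open S" "x \<in> S" "\<And>y. y \<in> S \<Longrightarrow> f y = g y" "f differentiable (at x)"
  shows "g differentiable (at x)"
  using assms has_derivative_transform_within_open[of f _ x UNIV S g]
  unfolding differentiable_def by blast

text \<open>Openness matters because the derivatives in \<open>Ck_on\<close> are taken in the full
  space; agreement on \<open>S\<close> then means agreement near each of its points.\<close>

lemma Ck_on_cong:
  assumes "open S" "\<And>x. x \<in> S \<Longrightarrow> f x = g x" "Ck_on k f S"
  shows "Ck_on k g S"
  using assms(2,3)
proof (induction k arbitrary: f g)
  case 0
  then show ?case by (simp cong: continuous_on_cong)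
next
  case (Suc k)
  show ?case
    unfolding Ck_on.simps
  proof (intro conjI ballI allI)
    show "g differentiable (at x)" if "x \<in> S" for x
      using Suc.prems that assms(1) differentiable_cong_open[of S x f g] by auto
    show "Ck_on k (\<lambda>x. frechet_derivative g (at x) v) S" for v
    proof (rule Suc.IH)
      show "frechet_derivative f (at x) v = frechet_derivative g (at x) v" if "x \<in> S" for x
        using frechet_derivative_cong_open[OF assms(1) that Suc.prems(1)] by simp
      show "Ck_on k (\<lambda>x. frechet_derivative f (at x) v) S"
        using Suc.prems(2) by simp
    qed
  qed
qed

lemma Ck_on_Suc_imp: "Ck_on (Suc k) f S \<Longrightarrow> Ck_on k f S"
proof (induction k arbitrary: f)
  case 0
  then show ?case
    by (auto intro!: continuous_at_imp_continuous_on differentiable_imp_continuous_within)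
next
  case (Suc k)
  then show ?case by (metis Ck_on.simps(2))
qed

lemma Ck_on_subset: "Ck_on k f S \<Longrightarrow> T \<subseteq> S \<Longrightarrow> Ck_on k f T"
  by (induction k arbitrary: f) (auto intro: continuous_on_subset)

lemma Ck_on_local:
  assumes "\<And>x. x \<in> S \<Longrightarrow> \<exists>T. open T \<and> x \<in> T \<and> Ck_on k f T"
  shows "Ck_on k f S"
  using assms
proof (induction k arbitrary: f)
  case 0
  then show ?case
    by (simp, metis continuous_at_imp_continuous_on continuous_on_eq_continuous_at)
next
  case (Suc k)
  show ?case
    unfolding Ck_on.simps
  proof (intro conjI ballI allI)
    show "f differentiable (at x)" if "x \<in> S" for x
      using Suc.prems[OF that] by auto
    show "Ck_on k (\<lambda>x. frechet_derivative f (at x) v) S" for v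
      using Suc.prems by (intro Suc.IH) fastforce
  qed
qed

section \<open>Closure properties of \<open>C^k\<close> maps\<close>

lemma Ck_on_const: "Ck_on k (\<lambda>_. c) S"
  by (induction k arbitrary: c) auto

lemma Ck_on_add:
  assumes "open S" "Ck_on k f S" "Ck_on k g S"
  shows "Ck_on k (\<lambda>x. f x + g x) S"
  using assms(2,3)
proof (induction k arbitrary: f g)
  case 0
  then show ?case by (auto intro: continuous_on_add)
next
  case (Suc k)
  show ?case
    unfolding Ck_on.simps
  proof (intro conjI ballI allI)
    show "(\<lambda>x. f x + g x) differentiable (at x)" if "x \<in> S" for x
      using Suc.prems that by auto
    fix v
    have "Ck_on k (\<lambda>x. frechet_derivative f (at x) v + frechet_derivative g (at x) v) S"
      using Suc.prems by (intro Suc.IH) auto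
    then show "Ck_on k (\<lambda>x. frechet_derivative (\<lambda>x. f x + g x) (at x) v) S"
      by (rule Ck_on_cong[OF assms(1), rotated])
        (use Suc.prems in \<open>auto intro!: frechet_derivative_eq[symmetric, THEN fun_cong]
          has_derivative_add simp: frechet_derivative_works[symmetric]\<close>)
  qed
qed

lemma Ck_on_sum:
  assumes "open S" "\<And>i. i \<in> I \<Longrightarrow> Ck_on k (f i) S"
  shows "Ck_on k (\<lambda>x. \<Sum>i\<in>I. f i x) S"
  using assms(2)
  by (induction I rule: infinite_finite_induct) (auto simp: Ck_on_const intro: Ck_on_add[OF assms(1)])

lemma Ck_on_bilinear:
  assumes "bounded_bilinear m" "open S" "Ck_on k f S" "Ck_on k g S"
  shows "Ck_on k (\<lambda>x. m (f x) (g x)) S"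
  using assms(3,4)
proof (induction k arbitrary: f g)
  case 0
  then show ?case using bounded_bilinear.continuous_on[OF assms(1)] by auto
next
  case (Suc k)
  have D: "((\<lambda>x. m (f x) (g x)) has_derivative
      (\<lambda>v. m (f x) (frechet_derivative g (at x) v) + m (frechet_derivative f (at x) v) (g x))) (at x)"
    if "x \<in> S" for x
    using Suc.prems that
    by (intro bounded_bilinear.FDERIV[OF assms(1)]) (auto simp: frechet_derivative_works)
  show ?case
    unfolding Ck_on.simps
  proof (intro conjI ballI allI)
    show "(\<lambda>x. m (f x) (g x)) differentiable (at x)" if "x \<in> S" for x
      using D[OF that] by (auto simp: differentiable_def)
    fix v
    \<comment> \<open>Both terms have the shape \<open>m f g\<close> again. In each, one factor is a
      derivative and the other is an original function, weakened from order \<open>Suc k\<close> to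
      \<open>k\<close>.\<close>
    have "Ck_on k (\<lambda>x. m (f x) (frechet_derivative g (at x) v) +
        m (frechet_derivative f (at x) v) (g x)) S"
      using Suc.prems Suc.prems[THEN Ck_on_Suc_imp] by (intro Ck_on_add Suc.IH assms(2)) auto
    then show "Ck_on k (\<lambda>x. frechet_derivative (\<lambda>x. m (f x) (g x)) (at x) v) S"
      by (rule Ck_on_cong[OF assms(2), rotated]) (simp add: frechet_derivative_eq[OF D])
  qed
qed

lemma linear_euclidean_expand:
  fixes f :: "'a::euclidean_space \<Rightarrow> 'b::real_vector"
  assumes "linear f"
  shows "f x = (\<Sum>b\<in>Basis. (x \<bullet> b) *\<^sub>R f b)"
proof -
  have "f x = f (\<Sum>b\<in>Basis. (x \<bullet> b) *\<^sub>R b)" by (simp add: euclidean_representation)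
  also have "\<dots> = (\<Sum>b\<in>Basis. (x \<bullet> b) *\<^sub>R f b)"
    by (simp add: linear_sum[OF assms] linear_cmul[OF assms])
  finally show ?thesis .
qed

lemma has_derivative_linear: "(f has_derivative f') F \<Longrightarrow> linear f'"
  using has_derivative_bounded_linear bounded_linear.linear by blast

lemma linear_frechet_derivative_at: "f differentiable (at x) \<Longrightarrow> linear (frechet_derivative f (at x))"
  using frechet_derivative_works has_derivative_linear by blast

lemma Ck_on_compose:
  fixes f :: "'a::real_normed_vector \<Rightarrow> 'b::euclidean_space"
  assumes "open S" "open T" "Ck_on k f S" "Ck_on k g T" "f ` S \<subseteq> T"
  shows "Ck_on k (\<lambda>x. g (f x)) S"
  using assms(3-5)
proof (induction k arbitrary: f g)
  case 0
  then show ?case using continuous_on_compose2 by auto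
next
  case (Suc k)
  have D: "((\<lambda>x. g (f x)) has_derivative
      (\<lambda>v. frechet_derivative g (at (f x)) (frechet_derivative f (at x) v))) (at x)"
    if "x \<in> S" for x
  proof -
    have "f x \<in> T" using Suc.prems(3) that by blast
    then have "f differentiable (at x)" "g differentiable (at (f x))"
      using Suc.prems(1,2) that by auto
    then show ?thesis
      unfolding frechet_derivative_works by (rule has_derivative_compose)
  qed
  show ?case
    unfolding Ck_on.simps
  proof (intro conjI ballI allI)
    show "(\<lambda>x. g (f x)) differentiable (at x)" if "x \<in> S" for x
      using D[OF that] by (auto simp: differentiable_def)
    fix v
    \<comment> \<open>\<open>Ck_on\<close> controls derivatives in fixed directions only, whereas
      the chain rule differentiates \<open>g\<close> in a direction that varies with
      \<open>x\<close>. Expanding that direction in the basis leaves fixed directions with scalar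
      coefficients.\<close>
    have "Ck_on k (\<lambda>x. \<Sum>b\<in>Basis. (frechet_derivative f (at x) v \<bullet> b) *\<^sub>R
        frechet_derivative g (at (f x)) b) S"
    proof (intro Ck_on_sum assms(1) Ck_on_bilinear[OF bounded_bilinear_scaleR])
      fix b :: 'b
      show "Ck_on k (\<lambda>x. frechet_derivative f (at x) v \<bullet> b) S"
        using Suc.prems(1)
        by (intro Ck_on_bilinear[OF bounded_bilinear_inner] assms(1) Ck_on_const) auto
      show "Ck_on k (\<lambda>x. frechet_derivative g (at (f x)) b) S"
        using Suc.prems Ck_on_Suc_imp[OF Suc.prems(1)]
        by (intro Suc.IH[where g = "\<lambda>y. frechet_derivative g (at y) b"]) auto
    qed
    then show "Ck_on k (\<lambda>x. frechet_derivative (\<lambda>x. g (f x)) (at x) v) S"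
    proof (rule Ck_on_cong[OF assms(1), rotated])
      fix x assume x: "x \<in> S"
      then have "g differentiable (at (f x))" using Suc.prems by auto
      then show "(\<Sum>b\<in>Basis. (frechet_derivative f (at x) v \<bullet> b) *\<^sub>R
          frechet_derivative g (at (f x)) b) = frechet_derivative (\<lambda>x. g (f x)) (at x) v"
        by (simp add: frechet_derivative_eq[OF D[OF x]]
            linear_euclidean_expand[OF linear_frechet_derivative_at, symmetric])
    qed
  qed
qed

lemma Ck_on_inverse: "Ck_on k (inverse :: real \<Rightarrow> real) (- {0})"
proof (induction k)
  case 0
  then show ?case by (auto intro: continuous_intros)
next
  case (Suc k)
  have D: "((inverse :: real \<Rightarrow> real) has_derivative (\<lambda>v. - (inverse x * v * inverse x))) (at x)"
    if "x \<noteq> 0" for x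
    using has_derivative_inverse'[OF that] .
  have o: "open (- {0::real})" by auto
  show ?case
    unfolding Ck_on.simps
  proof (intro conjI ballI allI)
    show "(inverse :: real \<Rightarrow> real) differentiable (at x)" if "x \<in> - {0}" for x
      using D that by (auto simp: differentiable_def)
    fix v :: real
    \<comment> \<open>The derivative is a polynomial in \<open>inverse\<close> itself, so the
      induction hypothesis and the product rule suffice.\<close>
    have "Ck_on k (\<lambda>x. - v * (inverse x * inverse x)) (- {0})"
      by (intro Ck_on_bilinear[OF bounded_bilinear_mult o] Ck_on_const Suc)
    then show "Ck_on k (\<lambda>x::real. frechet_derivative inverse (at x) v) (- {0})"
      by (rule Ck_on_cong[OF o, rotated]) (simp add: frechet_derivative_eq[OF D])
  qed
qed

section \<open>Closure properties of smooth maps\<close>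

lemma smooth_on_cong: "open S \<Longrightarrow> (\<And>x. x \<in> S \<Longrightarrow> f x = g x) \<Longrightarrow> smooth_on f S \<Longrightarrow> smooth_on g S"
  using Ck_on_cong unfolding smooth_on_def by blast

lemma smooth_on_subset: "smooth_on f S \<Longrightarrow> T \<subseteq> S \<Longrightarrow> smooth_on f T"
  using Ck_on_subset unfolding smooth_on_def by blast

lemma smooth_on_local:
  "(\<And>x. x \<in> S \<Longrightarrow> \<exists>T. open T \<and> x \<in> T \<and> smooth_on f T) \<Longrightarrow> smooth_on f S"
  unfolding smooth_on_def by (metis Ck_on_local)

lemma smooth_on_const: "smooth_on (\<lambda>_. c) S"
  by (simp add: smooth_on_def Ck_on_const)

lemma smooth_on_add:
  "open S \<Longrightarrow> smooth_on f S \<Longrightarrow> smooth_on g S \<Longrightarrow> smooth_on (\<lambda>x. f x + g x) S"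
  by (simp add: smooth_on_def Ck_on_add)

lemma smooth_on_sum:
  "open S \<Longrightarrow> (\<And>i. i \<in> I \<Longrightarrow> smooth_on (f i) S) \<Longrightarrow> smooth_on (\<lambda>x. \<Sum>i\<in>I. f i x) S"
  by (simp add: smooth_on_def Ck_on_sum)

lemma smooth_on_bilinear:
  "bounded_bilinear m \<Longrightarrow> open S \<Longrightarrow> smooth_on f S \<Longrightarrow> smooth_on g S \<Longrightarrow>
    smooth_on (\<lambda>x. m (f x) (g x)) S"
  by (simp add: smooth_on_def Ck_on_bilinear)

lemma smooth_on_compose:
  fixes f :: "'a::real_normed_vector \<Rightarrow> 'b::euclidean_space"
  assumes "open S" "open T" "smooth_on f S" "smooth_on g T" "f ` S \<subseteq> T"
  shows "smooth_on (\<lambda>x. g (f x)) S"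
  using assms unfolding smooth_on_def by (auto intro: Ck_on_compose)

lemma smooth_on_inverse: "smooth_on (inverse :: real \<Rightarrow> real) (- {0})"
  by (simp add: smooth_on_def Ck_on_inverse)

lemma smooth_on_differentiable: "smooth_on f S \<Longrightarrow> x \<in> S \<Longrightarrow> f differentiable (at x)"
  by (metis Ck_on.simps(2) smooth_on_def)

lemma smooth_on_frechet_derivative:
  "smooth_on f S \<Longrightarrow> smooth_on (\<lambda>x. frechet_derivative f (at x) v) S"
  by (metis Ck_on.simps(2) smooth_on_def)

text \<open>Directions that vary with the point are what differentiation along a vector field
  requires; the basis expansion reduces them to fixed ones.\<close>

lemma smooth_on_frechet_derivative_apply:
  fixes f :: "'a::euclidean_space \<Rightarrow> 'b::real_normed_vector"
  assumes "open S" "smooth_on f S" "smooth_on X S"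
  shows "smooth_on (\<lambda>x. frechet_derivative f (at x) (X x)) S"
proof -
  have "smooth_on (\<lambda>x. \<Sum>b\<in>Basis. (X x \<bullet> b) *\<^sub>R frechet_derivative f (at x) b) S"
    by (intro smooth_on_sum smooth_on_bilinear[OF bounded_bilinear_scaleR] assms(1)
        smooth_on_bilinear[OF bounded_bilinear_inner] assms(3) smooth_on_const
        smooth_on_frechet_derivative assms(2))
  then show ?thesis
    by (rule smooth_on_cong[OF assms(1), rotated])
      (simp add: linear_euclidean_expand[OF linear_frechet_derivative_at, symmetric]
        smooth_on_differentiable[OF assms(2)])
qed

text \<open>All derivatives of \<open>exp (- 1 / x)\<close> extended by 0 have the form below, which is what makes the
  induction over the order of differentiability go through.\<close>

definition flat_exp :: "real poly \<Rightarrow> real \<Rightarrow> real" where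
  "flat_exp P x = (if 0 < x then poly P (inverse x) * exp (- inverse x) else 0)"

text \<open>With \<open>y = 1 / x\<close> this is the limit of \<open>P y / exp y\<close> at
  infinity, taken monomial by monomial.\<close>

lemma tendsto_flat_exp_0: "((\<lambda>x. poly P (inverse x) * exp (- inverse x)) \<longlongrightarrow> 0) (at_right (0::real))"
proof -
  have "((\<lambda>x. poly P x * exp (- x)) \<longlongrightarrow> 0) (at_top :: real filter)"
  proof -
    have "((\<lambda>x. \<Sum>i\<le>degree P. coeff P i * (x ^ i / exp x)) \<longlongrightarrow> (\<Sum>i\<le>degree P. coeff P i * 0)) (at_top :: real filter)"
      by (intro tendsto_intros tendsto_power_div_exp_0)
    then show ?thesis
      by (simp add: poly_altdef sum_distrib_right exp_minus divide_inverse mult.assoc)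
  qed
  from filterlim_compose[OF this filterlim_inverse_at_top_right] show ?thesis .
qed

text \<open>For positive \<open>x\<close>, differentiating \<open>P (1 / x) * exp (- 1 / x)\<close>
  gives \<open>(1 / x)^2 * (P - P') (1 / x) * exp (- 1 / x)\<close>; this is where the polynomial
  \<open>X^2 (P - P')\<close> comes from. At 0 both one-sided difference quotients tend to
  0.\<close>

lemma flat_exp_has_derivative:
  "(flat_exp P has_real_derivative flat_exp ([:0, 0, 1:] * (P - pderiv P)) x) (at x)"
proof -
  consider "x < 0" | "x = 0" | "0 < x" by linarith
  then show ?thesis
  proof cases
    case 1
    have "((\<lambda>_. 0) has_real_derivative 0) (at x)" by simp
    then show ?thesis
      using 1 has_field_derivative_transform_within_open[of "\<lambda>_. 0" 0 x "{..<0}" "flat_exp P"]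
      by (simp add: flat_exp_def)
  next
    case 3
    have P: "((\<lambda>x. poly P (inverse x)) has_real_derivative
        poly (pderiv P) (inverse x) * - (inverse x * 1 * inverse x)) (at x)"
      using 3 by (intro DERIV_chain2[OF poly_DERIV] DERIV_inverse'[OF DERIV_ident]) auto
    have E: "((\<lambda>x. exp (- inverse x)) has_real_derivative
        exp (- inverse x) * - (- (inverse x * 1 * inverse x))) (at x)"
      using 3 by (intro DERIV_chain2[OF DERIV_exp] DERIV_minus DERIV_inverse'[OF DERIV_ident]) auto
    have "((\<lambda>x. poly P (inverse x) * exp (- inverse x)) has_real_derivative
        flat_exp ([:0, 0, 1:] * (P - pderiv P)) x) (at x)"
      using DERIV_mult[OF P E] 3 by (simp add: flat_exp_def algebra_simps)
    then show ?thesis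
      using 3 has_field_derivative_transform_within_open[of _ _ x "{0<..}" "flat_exp P"]
      by (simp add: flat_exp_def)
  next
    case 2
    \<comment> \<open>Dividing by \<open>h\<close> multiplies the polynomial in \<open>1 / h\<close>
      by \<open>X\<close>, so the limit lemma applies to \<open>X P\<close>.\<close>
    have "((\<lambda>h. flat_exp P h / h) \<longlongrightarrow> 0) (at_right 0)"
    proof (rule Lim_transform_eventually[OF tendsto_flat_exp_0[of "[:0, 1:] * P"]])
      show "\<forall>\<^sub>F x in at_right 0. poly ([:0, 1:] * P) (inverse x) * exp (- inverse x) = flat_exp P x / x"
        by (auto simp: eventually_at_filter flat_exp_def field_simps)
    qed
    moreover have "((\<lambda>h. flat_exp P h / h) \<longlongrightarrow> 0) (at_left 0)"
    proof (rule Lim_transform_eventually[OF tendsto_const])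
      show "\<forall>\<^sub>F x in at_left 0. 0 = flat_exp P x / x"
        by (auto simp: eventually_at_filter flat_exp_def)
    qed
    ultimately have "((\<lambda>h. flat_exp P h / h) \<longlongrightarrow> 0) (at 0)"
      by (simp add: filterlim_split_at)
    then show ?thesis
      using 2 by (simp add: has_field_derivative_iff flat_exp_def)
  qed
qed

lemma Ck_on_flat_exp: "Ck_on k (flat_exp P) S"
proof (induction k arbitrary: P S)
  case 0
  then show ?case
    using flat_exp_has_derivative
    by (auto intro!: continuous_at_imp_continuous_on DERIV_isCont)
next
  case (Suc k)
  let ?Q = "[:0, 0, 1:] * (P - pderiv P)"
  have D: "(flat_exp P has_derivative (\<lambda>v. flat_exp ?Q x * v)) (at x)" for x
    using flat_exp_has_derivative by (simp add: has_field_derivative_def)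
  have D': "frechet_derivative (flat_exp P) (at x) = (\<lambda>v. flat_exp ?Q x * v)" for x
    using D by (rule frechet_derivative_eq)
  have "Ck_on k (\<lambda>x. flat_exp ?Q x * v) UNIV" for v
    by (intro Ck_on_bilinear[OF bounded_bilinear_mult] Ck_on_const open_UNIV Suc)
  from Ck_on_subset[OF this subset_UNIV] show ?case
    unfolding Ck_on.simps D' using D by (auto simp: differentiable_def)
qed

lemma smooth_on_flat_exp: "smooth_on (flat_exp P) S"
  by (simp add: smooth_on_def Ck_on_flat_exp)

section \<open>Calculus on a smooth manifold\<close>

locale smooth_manifold =
  fixes A :: "('m::{t2_space,second_countable_topology}, 'e::euclidean_space) atlas"
  assumes atlas: "smooth_atlas A"
begin

lemma open_cdom: "c \<in> A \<Longrightarrow> open (cdom c)"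
  using atlas by (simp add: smooth_atlas_def)

lemma chart_homeomorphism:
  "c \<in> A \<Longrightarrow> homeomorphism (cdom c) (cmap c ` cdom c) (cmap c) (cinv c)"
  using atlas by (simp add: smooth_atlas_def)

lemma cinv_cmap: "c \<in> A \<Longrightarrow> p \<in> cdom c \<Longrightarrow> cinv c (cmap c p) = p"
  using chart_homeomorphism by (simp add: homeomorphism_def)

lemma open_chart_image:
  assumes "c \<in> A" "open U"
  shows "open (cmap c ` (cdom c \<inter> U))"
proof -
  have "openin (top_of_set (cmap c ` cdom c)) (cmap c ` (cdom c \<inter> U))"
    using assms(2) by (intro homeomorphism_imp_open_map[OF chart_homeomorphism[OF assms(1)]])
      (auto simp: openin_open)
  moreover have "open (cmap c ` cdom c)"
    using atlas assms(1) by (simp add: smooth_atlas_def)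
  ultimately show ?thesis by (rule openin_open_trans)
qed

lemma chart_exists: obtains c where "c \<in> A" "p \<in> cdom c"
proof -
  have "p \<in> (\<Union>c\<in>A. cdom c)"
    using atlas unfolding smooth_atlas_def by blast
  with that show thesis by blast
qed

lemma chart_at: "chart_at A p \<in> A" "p \<in> cdom (chart_at A p)"
proof -
  have "chart_at A p \<in> A \<and> p \<in> cdom (chart_at A p)"
    unfolding chart_at_def by (rule someI_ex) (metis chart_exists)
  then show "chart_at A p \<in> A" "p \<in> cdom (chart_at A p)" by auto
qed

section \<open>Smooth functions\<close>

lemma smooth_funI:
  "(\<And>c. c \<in> A \<Longrightarrow> smooth_on (\<lambda>x. f (cinv c x)) (cmap c ` (cdom c \<inter> U))) \<Longrightarrow> smooth_fun A U f"
  by (simp add: smooth_fun_def o_def)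

lemma smooth_funD:
  "smooth_fun A U f \<Longrightarrow> c \<in> A \<Longrightarrow> smooth_on (\<lambda>x. f (cinv c x)) (cmap c ` (cdom c \<inter> U))"
  by (simp add: smooth_fun_def o_def)

lemma smooth_fun_cong:
  assumes "open U" "\<And>q. q \<in> U \<Longrightarrow> f q = h q" "smooth_fun A U f"
  shows "smooth_fun A U h"
proof (rule smooth_funI)
  fix c assume c: "c \<in> A"
  show "smooth_on (\<lambda>x. h (cinv c x)) (cmap c ` (cdom c \<inter> U))"
    by (rule smooth_on_cong[OF open_chart_image[OF c assms(1)] _ smooth_funD[OF assms(3) c]])
      (use assms(2) cinv_cmap[OF c] in auto)
qed

lemma smooth_fun_subset: "smooth_fun A U f \<Longrightarrow> V \<subseteq> U \<Longrightarrow> smooth_fun A V f"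
  by (rule smooth_funI, rule smooth_on_subset, rule smooth_funD) auto

lemma smooth_fun_local:
  assumes "\<And>p. p \<in> U \<Longrightarrow> \<exists>V. open V \<and> p \<in> V \<and> smooth_fun A V f"
  shows "smooth_fun A U f"
proof (rule smooth_funI, rule smooth_on_local)
  fix c x assume c: "c \<in> A" and "x \<in> cmap c ` (cdom c \<inter> U)"
  then obtain p where p: "p \<in> cdom c" "p \<in> U" "x = cmap c p" by auto
  from assms[OF p(2)] obtain V where V: "open V" "p \<in> V" "smooth_fun A V f" by auto
  then show "\<exists>T. open T \<and> x \<in> T \<and> smooth_on (\<lambda>x. f (cinv c x)) T"
    using p by (intro exI[of _ "cmap c ` (cdom c \<inter> V)"]) (auto simp: open_chart_image c smooth_funD)
qed

lemma smooth_fun_const: "smooth_fun A U (\<lambda>_. a)"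
  by (intro smooth_funI smooth_on_const)

lemma smooth_fun_add:
  "open U \<Longrightarrow> smooth_fun A U f \<Longrightarrow> smooth_fun A U h \<Longrightarrow> smooth_fun A U (\<lambda>q. f q + h q)"
  by (rule smooth_funI) (intro smooth_on_add open_chart_image smooth_funD)

lemma smooth_fun_sum:
  "open U \<Longrightarrow> (\<And>i. i \<in> I \<Longrightarrow> smooth_fun A U (f i)) \<Longrightarrow> smooth_fun A U (\<lambda>q. \<Sum>i\<in>I. f i q)"
  by (rule smooth_funI) (intro smooth_on_sum open_chart_image smooth_funD)

lemma smooth_fun_bilinear:
  assumes "bounded_bilinear m" "open U" "smooth_fun A U f" "smooth_fun A U h"
  shows "smooth_fun A U (\<lambda>q. m (f q) (h q))"
proof (rule smooth_funI)
  fix c assume c: "c \<in> A"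
  show "smooth_on (\<lambda>x. m (f (cinv c x)) (h (cinv c x))) (cmap c ` (cdom c \<inter> U))"
    by (rule smooth_on_bilinear[OF assms(1) open_chart_image[OF c assms(2)]
          smooth_funD[OF assms(3) c] smooth_funD[OF assms(4) c]])
qed

lemmas smooth_fun_mult = smooth_fun_bilinear[OF bounded_bilinear_mult]
lemmas smooth_fun_inner = smooth_fun_bilinear[OF bounded_bilinear_inner]

lemma smooth_fun_compose:
  fixes f :: "'m \<Rightarrow> 'b::euclidean_space"
  assumes "open U" "open T" "smooth_fun A U f" "smooth_on h T" "f ` U \<subseteq> T"
  shows "smooth_fun A U (\<lambda>q. h (f q))"
proof (rule smooth_funI)
  fix c assume c: "c \<in> A"
  show "smooth_on (\<lambda>x. h (f (cinv c x))) (cmap c ` (cdom c \<inter> U))"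
    by (rule smooth_on_compose[OF open_chart_image[OF c assms(1)] assms(2) smooth_funD[OF assms(3) c]
          assms(4)])
      (use assms(5) cinv_cmap[OF c] in auto)
qed

lemma smooth_fun_divide:
  fixes f h :: "'m \<Rightarrow> real"
  assumes "open U" "smooth_fun A U f" "smooth_fun A U h" "\<And>q. q \<in> U \<Longrightarrow> h q \<noteq> 0"
  shows "smooth_fun A U (\<lambda>q. f q / h q)"
  unfolding divide_inverse using assms
  by (intro smooth_fun_mult smooth_fun_compose[OF _ _ _ smooth_on_inverse]) auto

lemma smooth_fun_cmap:
  assumes "c \<in> A"
  shows "smooth_fun A (cdom c) (cmap c)"
  using atlas assms by (auto simp: smooth_atlas_def smooth_fun_def)

lemma smooth_fun_differentiable:
  assumes "smooth_fun A U f" "p \<in> U" "c \<in> A" "p \<in> cdom c"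
  shows "(\<lambda>x. f (cinv c x)) differentiable (at (cmap c p))"
  using smooth_on_differentiable[OF smooth_funD[OF assms(1,3)]] assms by auto

text \<open>Chain rule for \<open>f\<close> read in the chart \<open>d\<close> as \<open>f\<close>
  read in \<open>c\<close> after the transition map. That factorisation holds only on the overlap of
  the charts, hence the final passage through locality of derivatives.\<close>

lemma frechet_derivative_chart_change:
  assumes "open U" "smooth_fun A U f" "p \<in> U" "c \<in> A" "p \<in> cdom c" "d \<in> A" "p \<in> cdom d"
  shows "frechet_derivative (\<lambda>x. f (cinv d x)) (at (cmap d p)) w =
    frechet_derivative (\<lambda>x. f (cinv c x)) (at (cmap c p))
      (frechet_derivative (\<lambda>x. cmap c (cinv d x)) (at (cmap d p)) w)"
proof -
  have c: "((\<lambda>x. cmap c (cinv d x)) has_derivative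
      frechet_derivative (\<lambda>x. cmap c (cinv d x)) (at (cmap d p))) (at (cmap d p))"
    using smooth_fun_differentiable[OF smooth_fun_cmap] assms frechet_derivative_works by blast
  have f: "((\<lambda>x. f (cinv c x)) has_derivative
      frechet_derivative (\<lambda>x. f (cinv c x)) (at (cmap c p))) (at (cmap c p))"
    using smooth_fun_differentiable assms frechet_derivative_works by blast
  have "((\<lambda>x. f (cinv c (cmap c (cinv d x)))) has_derivative
    (\<lambda>w. frechet_derivative (\<lambda>x. f (cinv c x)) (at (cmap c p))
      (frechet_derivative (\<lambda>x. cmap c (cinv d x)) (at (cmap d p)) w))) (at (cmap d p))"
    using f by (intro has_derivative_compose[OF c]) (simp add: cinv_cmap assms)
  then have "frechet_derivative (\<lambda>x. f (cinv c (cmap c (cinv d x)))) (at (cmap d p)) w =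
      frechet_derivative (\<lambda>x. f (cinv c x)) (at (cmap c p))
      (frechet_derivative (\<lambda>x. cmap c (cinv d x)) (at (cmap d p)) w)"
    by (simp add: frechet_derivative_eq)
  moreover have "frechet_derivative (\<lambda>x. f (cinv c (cmap c (cinv d x)))) (at (cmap d p)) =
      frechet_derivative (\<lambda>x. f (cinv d x)) (at (cmap d p))"
    by (rule frechet_derivative_cong_open[of "cmap d ` (cdom d \<inter> cdom c)"])
      (use assms open_chart_image[OF assms(6) open_cdom[OF assms(4)]] in \<open>auto simp: cinv_cmap\<close>)
  ultimately show ?thesis by simp
qed

section \<open>Tangent spaces\<close>

lemma tspace_zero_outside: "v \<in> tspace A p \<Longrightarrow> \<not> (c \<in> A \<and> p \<in> cdom c) \<Longrightarrow> v c = 0"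
  unfolding tspace_def by blast

lemma tspace_chart_change:
  "v \<in> tspace A p \<Longrightarrow> c \<in> A \<Longrightarrow> p \<in> cdom c \<Longrightarrow> d \<in> A \<Longrightarrow> p \<in> cdom d \<Longrightarrow>
    v d = frechet_derivative (\<lambda>x. cmap d (cinv c x)) (at (cmap c p)) (v c)"
  unfolding tspace_def o_def by blast

lemma tspaceI:
  assumes "\<And>c. \<not> (c \<in> A \<and> p \<in> cdom c) \<Longrightarrow> v c = 0"
    and "\<And>c d. c \<in> A \<Longrightarrow> d \<in> A \<Longrightarrow> p \<in> cdom c \<Longrightarrow> p \<in> cdom d \<Longrightarrow>
      v d = frechet_derivative (\<lambda>x. cmap d (cinv c x)) (at (cmap c p)) (v c)"
  shows "v \<in> tspace A p"
  unfolding tspace_def o_def using assms by blast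

lemma linear_chart_change:
  assumes "c \<in> A" "p \<in> cdom c" "d \<in> A" "p \<in> cdom d"
  shows "linear (frechet_derivative (\<lambda>x. cmap d (cinv c x)) (at (cmap c p)))"
  using assms by (intro linear_frechet_derivative_at smooth_fun_differentiable[OF smooth_fun_cmap])

text \<open>The transformation law fixes the components in all charts around \<open>p\<close>, and
  the others are 0; identities between tangent vectors thus need checking in one chart only.\<close>

lemma tspace_eqI:
  assumes "v \<in> tspace A p" "w \<in> tspace A p" "c \<in> A" "p \<in> cdom c" "v c = w c"
  shows "v = w"
proof
  fix d show "v d = w d"
    using assms tspace_zero_outside[of _ p d] tspace_chart_change[of _ p c d] by metis
qed

lemma subspace_tspace: "subspace (tspace A p)"
  unfolding subspace_def
proof (intro conjI ballI allI)
  show "0 \<in> tspace A p"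
    by (rule tspaceI) (simp_all add: linear_0 linear_chart_change)
  show "v + w \<in> tspace A p" if v: "v \<in> tspace A p" and w: "w \<in> tspace A p" for v w
  proof (rule tspaceI)
    fix c d assume c: "c \<in> A" "d \<in> A" "p \<in> cdom c" "p \<in> cdom d"
    show "(v + w) d = frechet_derivative (\<lambda>x. cmap d (cinv c x)) (at (cmap c p)) ((v + w) c)"
      using tspace_chart_change[OF v, of c d] tspace_chart_change[OF w, of c d] c
      by (simp add: linear_add[OF linear_chart_change])
  qed (simp add: tspace_zero_outside[OF v] tspace_zero_outside[OF w])
  show "a *\<^sub>R v \<in> tspace A p" if v: "v \<in> tspace A p" for v a
  proof (rule tspaceI)
    fix c d assume c: "c \<in> A" "d \<in> A" "p \<in> cdom c" "p \<in> cdom d"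
    show "(a *\<^sub>R v) d = frechet_derivative (\<lambda>x. cmap d (cinv c x)) (at (cmap c p)) ((a *\<^sub>R v) c)"
      using tspace_chart_change[OF v, of c d] c
      by (simp add: scaleR_fun_def linear_cmul[OF linear_chart_change])
  qed (simp add: scaleR_fun_def tspace_zero_outside[OF v])
qed

lemmas tspace_add = subspace_add[OF subspace_tspace]
lemmas tspace_scale = subspace_scale[OF subspace_tspace]
lemmas tspace_diff = subspace_diff[OF subspace_tspace]
lemmas tspace_0 = subspace_0[OF subspace_tspace]

text \<open>\<open>dirderiv\<close> is computed in an arbitrarily chosen chart. The chain rule for
  \<open>f\<close> and the transformation law of \<open>v\<close> compensate each other, which frees
  later arguments from that choice.\<close>

lemma dirderiv_chart:
  assumes "open U" "smooth_fun A U f" "p \<in> U" "v \<in> tspace A p" "c \<in> A" "p \<in> cdom c"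
  shows "dirderiv A p v f = frechet_derivative (\<lambda>x. f (cinv c x)) (at (cmap c p)) (v c)"
  using frechet_derivative_chart_change[OF assms(1-3,5,6) chart_at(1,2)]
    tspace_chart_change[OF assms(4) chart_at assms(5,6)]
  by (simp add: dirderiv_def Let_def o_def)

lemma linear_dirderiv:
  assumes "smooth_fun A U f" "p \<in> U"
  shows "linear (\<lambda>v. dirderiv A p v f)"
proof -
  have "linear (frechet_derivative (\<lambda>x. f (cinv (chart_at A p) x)) (at (cmap (chart_at A p) p)))"
    using assms chart_at by (intro linear_frechet_derivative_at smooth_fun_differentiable)
  then show ?thesis
    by (auto simp: dirderiv_def Let_def o_def linear_iff scaleR_fun_def)
qed

lemma dirderiv_cong:
  assumes "open U" "p \<in> U" "\<And>q. q \<in> U \<Longrightarrow> f q = h q"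
  shows "dirderiv A p v f = dirderiv A p v h"
proof -
  have "frechet_derivative (\<lambda>x. f (cinv (chart_at A p) x)) (at (cmap (chart_at A p) p)) =
      frechet_derivative (\<lambda>x. h (cinv (chart_at A p) x)) (at (cmap (chart_at A p) p))"
    by (rule frechet_derivative_cong_open[of "cmap (chart_at A p) ` (cdom (chart_at A p) \<inter> U)"])
      (use assms chart_at open_chart_image[OF chart_at(1) assms(1)] in \<open>auto simp: cinv_cmap\<close>)
  then show ?thesis by (simp add: dirderiv_def Let_def o_def)
qed

lemma dirderiv_const: "dirderiv A p v (\<lambda>_. a) = 0"
  by (simp add: dirderiv_def Let_def o_def)

lemma dirderiv_bilinear:
  assumes "bounded_bilinear m" "smooth_fun A U f" "smooth_fun A U h" "p \<in> U"
  shows "dirderiv A p v (\<lambda>q. m (f q) (h q)) =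
    m (f p) (dirderiv A p v h) + m (dirderiv A p v f) (h p)"
proof -
  let ?c = "chart_at A p"
  have "((\<lambda>x. m (f (cinv ?c x)) (h (cinv ?c x))) has_derivative
    (\<lambda>w. m (f (cinv ?c (cmap ?c p))) (frechet_derivative (\<lambda>x. h (cinv ?c x)) (at (cmap ?c p)) w) +
      m (frechet_derivative (\<lambda>x. f (cinv ?c x)) (at (cmap ?c p)) w) (h (cinv ?c (cmap ?c p)))))
    (at (cmap ?c p))"
    using assms chart_at
    by (intro bounded_bilinear.FDERIV[OF assms(1)] frechet_derivative_works[THEN iffD1]
        smooth_fun_differentiable)
  then show ?thesis
    by (simp add: dirderiv_def Let_def o_def frechet_derivative_eq cinv_cmap chart_at)
qed

lemmas dirderiv_mult = dirderiv_bilinear[OF bounded_bilinear_mult]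
lemmas dirderiv_inner = dirderiv_bilinear[OF bounded_bilinear_inner]

lemma dirderiv_sum:
  assumes "\<And>i. i \<in> I \<Longrightarrow> smooth_fun A U (f i)" "p \<in> U"
  shows "dirderiv A p v (\<lambda>q. \<Sum>i\<in>I. f i q) = (\<Sum>i\<in>I. dirderiv A p v (f i))"
proof -
  let ?c = "chart_at A p"
  have "((\<lambda>x. \<Sum>i\<in>I. f i (cinv ?c x)) has_derivative
    (\<lambda>w. \<Sum>i\<in>I. frechet_derivative (\<lambda>x. f i (cinv ?c x)) (at (cmap ?c p)) w)) (at (cmap ?c p))"
    using assms chart_at
    by (intro has_derivative_sum frechet_derivative_works[THEN iffD1] smooth_fun_differentiable)
  then show ?thesis
    by (simp add: dirderiv_def Let_def o_def frechet_derivative_eq)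
qed

section \<open>Coordinate fields\<close>

lemma coord_field_apply:
  "d \<in> A \<Longrightarrow> q \<in> cdom d \<Longrightarrow>
    coord_field A c w q d = frechet_derivative (\<lambda>x. cmap d (cinv c x)) (at (cmap c q)) w"
  by (simp add: coord_field_def o_def)

text \<open>The transformation law is here the cocycle identity of the transition maps, that is, the
  chain rule applied to the chart map of \<open>d'\<close>.\<close>

lemma coord_field_in_tspace:
  assumes "c \<in> A" "q \<in> cdom c"
  shows "coord_field A c w q \<in> tspace A q"
proof (rule tspaceI)
  fix d d' assume d: "d \<in> A" "d' \<in> A" "q \<in> cdom d" "q \<in> cdom d'"
  then show "coord_field A c w q d' =
      frechet_derivative (\<lambda>x. cmap d' (cinv d x)) (at (cmap d q)) (coord_field A c w q d)"
    using d assms frechet_derivative_chart_change[OF open_cdom[OF d(2)] smooth_fun_cmap[OF d(2)], of q d c]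
    by (simp add: coord_field_apply)
qed (auto simp: coord_field_def)

lemma coord_field_same:
  assumes "c \<in> A" "q \<in> cdom c"
  shows "coord_field A c w q c = w"
proof -
  have "frechet_derivative (\<lambda>x. cmap c (cinv c x)) (at (cmap c q)) =
      frechet_derivative (\<lambda>x. x) (at (cmap c q))"
    by (rule frechet_derivative_cong_open[of "cmap c ` (cdom c \<inter> UNIV)"])
      (use assms open_chart_image[OF assms(1), of UNIV] in \<open>auto simp: cinv_cmap\<close>)
  then show ?thesis
    by (simp add: coord_field_apply assms)
qed

lemma coord_field_component:
  assumes "v \<in> tspace A q" "c \<in> A" "q \<in> cdom c"
  shows "coord_field A c (v c) q = v"
  by (rule tspace_eqI[OF coord_field_in_tspace assms(1), where c = c]) (simp_all add: assms coord_field_same)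

lemma linear_coord_field:
  assumes "c \<in> A" "q \<in> cdom c"
  shows "linear (\<lambda>w. coord_field A c w q)"
proof (rule linearI)
  show "coord_field A c (w + w') q = coord_field A c w q + coord_field A c w' q" for w w'
    using assms
    by (intro tspace_eqI[of _ q] coord_field_in_tspace tspace_add) (auto simp: coord_field_same)
  show "coord_field A c (a *\<^sub>R w) q = a *\<^sub>R coord_field A c w q" for w a
    using assms
    by (intro tspace_eqI[of _ q] coord_field_in_tspace tspace_scale)
      (auto simp: coord_field_same scaleR_fun_def)
qed

section \<open>Smooth vector fields\<close>

lemma smooth_vfI:
  "(\<And>q. q \<in> U \<Longrightarrow> X q \<in> tspace A q) \<Longrightarrow>
    (\<And>c. c \<in> A \<Longrightarrow> smooth_on (\<lambda>x. X (cinv c x) c) (cmap c ` (cdom c \<inter> U))) \<Longrightarrow> smooth_vf A U X"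
  by (simp add: smooth_vf_def)

lemma smooth_vf_tspace: "smooth_vf A U X \<Longrightarrow> q \<in> U \<Longrightarrow> X q \<in> tspace A q"
  by (simp add: smooth_vf_def)

lemma smooth_vfD:
  "smooth_vf A U X \<Longrightarrow> c \<in> A \<Longrightarrow> smooth_on (\<lambda>x. X (cinv c x) c) (cmap c ` (cdom c \<inter> U))"
  by (simp add: smooth_vf_def)

lemma smooth_vf_cong:
  assumes "open U" "\<And>q. q \<in> U \<Longrightarrow> X q = Y q" "smooth_vf A U X"
  shows "smooth_vf A U Y"
proof (rule smooth_vfI)
  fix c assume c: "c \<in> A"
  show "smooth_on (\<lambda>x. Y (cinv c x) c) (cmap c ` (cdom c \<inter> U))"
    by (rule smooth_on_cong[OF open_chart_image[OF c assms(1)] _ smooth_vfD[OF assms(3) c]])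
      (use assms(2) cinv_cmap[OF c] in auto)
qed (use smooth_vf_tspace[OF assms(3)] assms(2) in auto)

lemma smooth_vf_subset: "smooth_vf A U X \<Longrightarrow> V \<subseteq> U \<Longrightarrow> smooth_vf A V X"
  by (rule smooth_vfI, use smooth_vf_tspace in blast, rule smooth_on_subset, rule smooth_vfD) auto

lemma smooth_vf_local:
  assumes "\<And>p. p \<in> U \<Longrightarrow> \<exists>V. open V \<and> p \<in> V \<and> smooth_vf A V X"
  shows "smooth_vf A U X"
proof (rule smooth_vfI)
  show "X q \<in> tspace A q" if "q \<in> U" for q
    using assms[OF that] smooth_vf_tspace by blast
next
  fix c assume c: "c \<in> A"
  show "smooth_on (\<lambda>x. X (cinv c x) c) (cmap c ` (cdom c \<inter> U))"
  proof (rule smooth_on_local)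
    fix x assume "x \<in> cmap c ` (cdom c \<inter> U)"
    then obtain p where p: "p \<in> cdom c" "p \<in> U" "x = cmap c p" by auto
    from assms[OF p(2)] obtain V where V: "open V" "p \<in> V" "smooth_vf A V X" by auto
    then show "\<exists>T. open T \<and> x \<in> T \<and> smooth_on (\<lambda>x. X (cinv c x) c) T"
      using p by (intro exI[of _ "cmap c ` (cdom c \<inter> V)"]) (auto simp: open_chart_image c smooth_vfD)
  qed
qed

lemma smooth_vf_zero: "smooth_vf A U (\<lambda>_. 0)"
  by (rule smooth_vfI) (auto simp: tspace_0 smooth_on_const)

lemma smooth_vf_add:
  "open U \<Longrightarrow> smooth_vf A U X \<Longrightarrow> smooth_vf A U Y \<Longrightarrow> smooth_vf A U (\<lambda>q. X q + Y q)"
  by (rule smooth_vfI)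
    (auto intro!: tspace_add smooth_on_add open_chart_image dest: smooth_vf_tspace smooth_vfD)

lemma smooth_vf_scale:
  "open U \<Longrightarrow> smooth_fun A U f \<Longrightarrow> smooth_vf A U X \<Longrightarrow> smooth_vf A U (\<lambda>q. f q *\<^sub>R X q)"
  by (rule smooth_vfI)
    (auto simp: scaleR_fun_def intro!: tspace_scale[unfolded scaleR_fun_def]
      smooth_on_bilinear[OF bounded_bilinear_scaleR] open_chart_image
      dest: smooth_vf_tspace smooth_vfD smooth_funD)

lemma smooth_vf_diff:
  assumes "open U" "smooth_vf A U X" "smooth_vf A U Y"
  shows "smooth_vf A U (\<lambda>q. X q - Y q)"
  using smooth_vf_add[OF assms(1,2) smooth_vf_scale[OF assms(1) smooth_fun_const[of U "-1"] assms(3)]]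
  by simp

lemma smooth_vf_coord_field:
  assumes "c \<in> A"
  shows "smooth_vf A (cdom c) (coord_field A c w)"
proof (rule smooth_vfI)
  fix d assume d: "d \<in> A"
  let ?T = "cmap c ` (cdom c \<inter> cdom d)" and ?S = "cmap d ` (cdom d \<inter> cdom c)"
  have o: "open ?S" "open ?T"
    by (intro open_chart_image open_cdom assms d)+
  have "smooth_on (\<lambda>x. frechet_derivative (\<lambda>y. cmap d (cinv c y)) (at (cmap c (cinv d x))) w) ?S"
    by (rule smooth_on_compose[OF o smooth_funD[OF smooth_fun_cmap[OF assms] d]
        smooth_on_frechet_derivative[OF smooth_funD[OF smooth_fun_cmap[OF d] assms]]])
      (auto simp: cinv_cmap d)
  then show "smooth_on (\<lambda>x. coord_field A c w (cinv d x) d) ?S"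
    by (rule smooth_on_cong[OF o(1), rotated]) (auto simp: cinv_cmap d coord_field_apply)
qed (simp add: coord_field_in_tspace assms)

lemma smooth_fun_dirderiv:
  assumes "open U" "smooth_fun A U f" "smooth_vf A U X"
  shows "smooth_fun A U (\<lambda>q. dirderiv A q (X q) f)"
proof (rule smooth_funI)
  fix c assume c: "c \<in> A"
  have o: "open (cmap c ` (cdom c \<inter> U))" using assms(1) c by (rule open_chart_image[rotated])
  have "smooth_on (\<lambda>x. frechet_derivative (\<lambda>y. f (cinv c y)) (at x) (X (cinv c x) c))
      (cmap c ` (cdom c \<inter> U))"
    by (intro smooth_on_frechet_derivative_apply o smooth_funD smooth_vfD assms c)
  then show "smooth_on (\<lambda>x. dirderiv A (cinv c x) (X (cinv c x)) f) (cmap c ` (cdom c \<inter> U))"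
    by (rule smooth_on_cong[OF o, rotated])
      (auto simp: cinv_cmap c dirderiv_chart[OF assms(1,2) _ smooth_vf_tspace[OF assms(3)] c])
qed

text \<open>The coordinate field with the components of \<open>v\<close> is cut off by a bump
  function whose support is a closed coordinate ball, and continued by 0.\<close>

lemma global_field_extension:
  assumes "v \<in> tspace A p"
  obtains X where "smooth_vf A UNIV X" "X p = v"
proof -
  obtain c where c: "c \<in> A" "p \<in> cdom c" by (rule chart_exists)
  have "open (cmap c ` cdom c)" using open_chart_image[OF c(1), of UNIV] by simp
  with c(2) obtain r where r: "0 < r" "cball (cmap c p) r \<subseteq> cmap c ` cdom c"
    unfolding open_contains_cball by blast
  \<comment> \<open>With the polynomial 1 this is \<open>exp (- 1 / (r^2 - s^2))\<close> at
    coordinate distance \<open>s < r\<close> from \<open>p\<close>, and 0 from distance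
    \<open>r\<close> on.\<close>
  define \<beta> where "\<beta> q = flat_exp 1 (r\<^sup>2 - (cmap c q - cmap c p) \<bullet> (cmap c q - cmap c p))" for q
  define K where "K = cinv c ` cball (cmap c p) r"
  have "compact K"
    unfolding K_def using r chart_homeomorphism[OF c(1)]
    by (intro compact_continuous_image compact_cball)
      (auto simp: homeomorphism_def intro: continuous_on_subset)
  \<comment> \<open>The Hausdorff property enters here: compact sets are closed, so the chart domain
    and the complement of \<open>K\<close> form an open cover on which smoothness can be checked
    separately.\<close>
  then have K: "open (- K)" by (simp add: compact_imp_closed open_Compl)
  have \<beta>: "smooth_fun A (cdom c) \<beta>"
  proof -
    have o: "open (cdom c)" using c open_cdom by blast
    have d: "smooth_fun A (cdom c) (\<lambda>q. cmap c q + (- cmap c p))"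
      by (intro smooth_fun_add o smooth_fun_cmap c smooth_fun_const)
    have "smooth_fun A (cdom c) (\<lambda>q. r\<^sup>2 + (-1) * ((cmap c q + (- cmap c p)) \<bullet> (cmap c q + (- cmap c p))))"
      by (intro smooth_fun_add smooth_fun_mult smooth_fun_const smooth_fun_inner d o)
    from smooth_fun_compose[OF o open_UNIV this smooth_on_flat_exp[of 1]] show ?thesis
      by (simp add: \<beta>_def [abs_def])
  qed
  have zero: "\<beta> q = 0" if "q \<in> cdom c" "q \<notin> K" for q
  proof -
    have "cmap c q \<notin> cball (cmap c p) r"
      using that cinv_cmap[OF c(1) that(1)] unfolding K_def by (metis imageI)
    then have "r < norm (cmap c q - cmap c p)" by (simp add: dist_norm norm_minus_commute)
    then have "r\<^sup>2 < (cmap c q - cmap c p) \<bullet> (cmap c q - cmap c p)"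
      using power_strict_mono[of r "norm (cmap c q - cmap c p)" 2] r(1) by (simp add: dot_square_norm)
    then show ?thesis by (simp add: \<beta>_def flat_exp_def)
  qed
  \<comment> \<open>Dividing by \<open>\<beta> p\<close> normalises the cut-off to 1 at
    \<open>p\<close>.\<close>
  define X where "X q = (if q \<in> cdom c then (\<beta> q / \<beta> p) *\<^sub>R coord_field A c (v c) q else 0)" for q
  have \<beta>p: "\<beta> p \<noteq> 0" using r(1) by (simp add: \<beta>_def flat_exp_def)
  have "smooth_vf A UNIV X"
  proof (rule smooth_vf_local)
    fix q
    show "\<exists>V. open V \<and> q \<in> V \<and> smooth_vf A V X"
    proof (cases "q \<in> cdom c")
      case True
      have "smooth_vf A (cdom c) (\<lambda>q. (\<beta> q / \<beta> p) *\<^sub>R coord_field A c (v c) q)"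
        using \<beta>p by (intro smooth_vf_scale smooth_vf_coord_field smooth_fun_divide smooth_fun_const \<beta>
            open_cdom c) auto
      then have "smooth_vf A (cdom c) X"
        by (rule smooth_vf_cong[OF open_cdom[OF c(1)], rotated]) (simp add: X_def)
      with True open_cdom[OF c(1)] show ?thesis by blast
    next
      case False
      then have "q \<in> - K" using r(2) by (auto simp: K_def cinv_cmap[OF c(1)] subset_iff)
      moreover have "smooth_vf A (- K) X"
        by (rule smooth_vf_cong[OF K _ smooth_vf_zero]) (auto simp: X_def zero)
      ultimately show ?thesis using K by blast
    qed
  qed
  moreover have "X p = v"
    using \<beta>p c assms by (simp add: X_def coord_field_component)
  ultimately show thesis by (rule that)
qed

end

section \<open>Smooth bilinear forms and their pullbacks\<close>

context smooth_manifold
begin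

text \<open>Symmetry and definiteness are left out so that metrics and skew 2-forms, on either
  manifold, share one calculus.\<close>

definition smooth_bilinear_form :: "('m, 'e) metric \<Rightarrow> bool" where
  "smooth_bilinear_form b \<longleftrightarrow>
     (\<forall>p. \<forall>u\<in>tspace A p. \<forall>v\<in>tspace A p. \<forall>w\<in>tspace A p.
        b p (u + v) w = b p u w + b p v w \<and> b p w (u + v) = b p w u + b p w v) \<and>
     (\<forall>p. \<forall>u\<in>tspace A p. \<forall>w\<in>tspace A p. \<forall>a.
        b p (a *\<^sub>R u) w = a * b p u w \<and> b p w (a *\<^sub>R u) = a * b p w u) \<and>
     (\<forall>U X Y. open U \<longrightarrow> smooth_vf A U X \<longrightarrow> smooth_vf A U Y \<longrightarrow>
        smooth_fun A U (\<lambda>p. b p (X p) (Y p)))"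

lemma form_smooth:
  "smooth_bilinear_form b \<Longrightarrow> open U \<Longrightarrow> smooth_vf A U X \<Longrightarrow> smooth_vf A U Y \<Longrightarrow>
    smooth_fun A U (\<lambda>p. b p (X p) (Y p))"
  unfolding smooth_bilinear_form_def by blast

context
  fixes b :: "('m, 'e) metric" and p :: 'm
  assumes b: "smooth_bilinear_form b"
begin

lemma form_add_left:
  "u \<in> tspace A p \<Longrightarrow> v \<in> tspace A p \<Longrightarrow> w \<in> tspace A p \<Longrightarrow> b p (u + v) w = b p u w + b p v w"
  using b by (simp add: smooth_bilinear_form_def)

lemma form_add_right:
  "u \<in> tspace A p \<Longrightarrow> v \<in> tspace A p \<Longrightarrow> w \<in> tspace A p \<Longrightarrow> b p w (u + v) = b p w u + b p w v"
  using b by (simp add: smooth_bilinear_form_def)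

lemma form_scale_left:
  "u \<in> tspace A p \<Longrightarrow> w \<in> tspace A p \<Longrightarrow> b p (a *\<^sub>R u) w = a * b p u w"
  using b by (simp add: smooth_bilinear_form_def)

lemma form_scale_right:
  "u \<in> tspace A p \<Longrightarrow> w \<in> tspace A p \<Longrightarrow> b p w (a *\<^sub>R u) = a * b p w u"
  using b by (simp add: smooth_bilinear_form_def)

lemma form_zero_left: "w \<in> tspace A p \<Longrightarrow> b p 0 w = 0"
  using form_scale_left[of 0 w 0] by (simp add: tspace_0)

lemma form_zero_right: "w \<in> tspace A p \<Longrightarrow> b p w 0 = 0"
  using form_scale_right[of 0 w 0] by (simp add: tspace_0)

lemma form_diff_left:
  "u \<in> tspace A p \<Longrightarrow> v \<in> tspace A p \<Longrightarrow> w \<in> tspace A p \<Longrightarrow> b p (u - v) w = b p u w - b p v w"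
  using form_add_left[of "u - v" v w] by (simp add: tspace_diff)

lemma form_diff_right:
  "u \<in> tspace A p \<Longrightarrow> v \<in> tspace A p \<Longrightarrow> w \<in> tspace A p \<Longrightarrow> b p w (u - v) = b p w u - b p w v"
  using form_add_right[of "u - v" v w] by (simp add: tspace_diff)

lemma form_sum_left:
  "(\<And>i. i \<in> I \<Longrightarrow> x i \<in> tspace A p) \<Longrightarrow> w \<in> tspace A p \<Longrightarrow> b p (\<Sum>i\<in>I. x i) w = (\<Sum>i\<in>I. b p (x i) w)"
  by (induction I rule: infinite_finite_induct)
    (simp_all add: form_zero_left form_add_left subspace_sum[OF subspace_tspace])

lemma form_sum_right:
  "(\<And>i. i \<in> I \<Longrightarrow> x i \<in> tspace A p) \<Longrightarrow> w \<in> tspace A p \<Longrightarrow> b p w (\<Sum>i\<in>I. x i) = (\<Sum>i\<in>I. b p w (x i))"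
  by (induction I rule: infinite_finite_induct)
    (simp_all add: form_zero_right form_add_right subspace_sum[OF subspace_tspace])

lemma form_zero_span:
  assumes "S \<subseteq> tspace A p" "n \<in> tspace A p" "\<And>x. x \<in> S \<Longrightarrow> b p n x = 0" "z \<in> span S"
  shows "b p n z = 0"
proof -
  have "subspace {z \<in> tspace A p. b p n z = 0}"
    using assms(2) by (auto simp: subspace_def tspace_0 tspace_add tspace_scale form_zero_right
        form_add_right form_scale_right)
  then have "z \<in> {z \<in> tspace A p. b p n z = 0}"
    using span_minimal[of S "{z \<in> tspace A p. b p n z = 0}"] assms by blast
  then show ?thesis by simp
qed

text \<open>Two linear maps are allowed because the product rule along a map pairs a coordinate
  frame in one slot with covariant derivatives of that frame in the other.\<close>

lemma form_expand:
  fixes P Q :: "'f::euclidean_space \<Rightarrow> ('m, 'e) tvec"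
  assumes "linear P" "linear Q" "\<And>w. P w \<in> tspace A p" "\<And>w. Q w \<in> tspace A p"
  shows "b p (P y) (Q z) = (\<Sum>i\<in>Basis. \<Sum>j\<in>Basis. (y \<bullet> i) * (z \<bullet> j) * b p (P i) (Q j))"
proof -
  have P: "P y = (\<Sum>i\<in>Basis. (y \<bullet> i) *\<^sub>R P i)" and Q: "Q z = (\<Sum>i\<in>Basis. (z \<bullet> i) *\<^sub>R Q i)"
    using linear_euclidean_expand assms by blast+
  have "b p (P y) (Q z) = (\<Sum>i\<in>Basis. (y \<bullet> i) * b p (P i) (Q z))"
    unfolding P using assms by (simp add: form_sum_left form_scale_left tspace_scale)
  moreover have "b p (P i) (Q z) = (\<Sum>j\<in>Basis. (z \<bullet> j) * b p (P i) (Q j))" for i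
    unfolding Q using assms by (simp add: form_sum_right form_scale_right tspace_scale)
  ultimately show ?thesis by (simp add: sum_distrib_left mult.assoc)
qed

end

lemma form_chart_expand:
  assumes "smooth_bilinear_form b" "c \<in> A" "p \<in> cdom c" "x \<in> tspace A p" "y \<in> tspace A p"
  shows "b p x y = (\<Sum>i\<in>Basis. \<Sum>j\<in>Basis. (x c \<bullet> i) * (y c \<bullet> j) *
    b p (coord_field A c i p) (coord_field A c j p))"
  using form_expand[OF assms(1) linear_coord_field[OF assms(2,3)] linear_coord_field[OF assms(2,3)],
      of p "x c" "y c"] assms coord_field_in_tspace coord_field_component by simp

text \<open>This inverts the Gram matrix of a frame smoothly, without determinants: a Gram-Schmidt
  step adds one frame field at a time. Independence is stated index by index, which also rules out
  repetitions and is inherited by smaller index sets.\<close>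

lemma form_solve_frame:
  fixes E :: "'i \<Rightarrow> ('m, 'e) vfield"
  assumes h: "smooth_bilinear_form h"
    and pos: "\<And>q u. u \<in> tspace A q \<Longrightarrow> u \<noteq> 0 \<Longrightarrow> 0 < h q u u"
    and U: "open U" and I: "finite I"
    and E: "\<And>i. i \<in> I \<Longrightarrow> smooth_vf A U (E i)"
    and indep: "\<And>q i. q \<in> U \<Longrightarrow> i \<in> I \<Longrightarrow> E i q \<notin> span ((\<lambda>j. E j q) ` (I - {i}))"
    and \<alpha>: "\<And>i. i \<in> I \<Longrightarrow> smooth_fun A U (\<alpha> i)"
  shows "\<exists>w. smooth_vf A U w \<and> (\<forall>q\<in>U. w q \<in> span ((\<lambda>j. E j q) ` I) \<and>
      (\<forall>i\<in>I. h q (w q) (E i q) = \<alpha> i q))"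
  using I E indep \<alpha>
proof (induction I arbitrary: \<alpha> rule: finite_induct)
  case empty
  show ?case
  proof (intro exI conjI ballI)
    show "smooth_vf A U (\<lambda>_. 0)" by (rule smooth_vf_zero)
  qed (simp_all add: fun_eq_iff)
next
  case (insert k I)
  have indI: "E i q \<notin> span ((\<lambda>j. E j q) ` (I - {i}))" if "q \<in> U" "i \<in> I" for q i
    using insert.prems(2)[OF that(1), of i] that
      span_mono[of "(\<lambda>j. E j q) ` (I - {i})" "(\<lambda>j. E j q) ` (insert k I - {i})"]
    by blast
  have Ek: "E k q \<notin> span ((\<lambda>j. E j q) ` I)" if "q \<in> U" for q
    using insert.prems(2)[OF that, of k] insert.hyps by simp
  have smE: "smooth_vf A U (E i)" if "i \<in> insert k I" for i
    using insert.prems(1) that by blast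
  have tE: "E i q \<in> tspace A q" if "i \<in> insert k I" "q \<in> U" for i q
    using smooth_vf_tspace[OF smE] that by blast
  \<comment> \<open>The induction hypothesis is used for two right-hand sides: first with the
    products of \<open>E k\<close>, giving its orthogonal projection \<open>pr\<close> to the span
    of the smaller frame, then with the given \<open>\<alpha>\<close>, giving a solution
    \<open>w0\<close> of all equations but the one for \<open>k\<close>.\<close>
  have "\<exists>w. smooth_vf A U w \<and> (\<forall>q\<in>U. w q \<in> span ((\<lambda>j. E j q) ` I) \<and>
    (\<forall>i\<in>I. h q (w q) (E i q) = h q (E k q) (E i q)))"
    using smE indI by (intro insert.IH form_smooth[OF h U]) auto
  then obtain pr where pr: "smooth_vf A U pr" "\<And>q. q \<in> U \<Longrightarrow> pr q \<in> span ((\<lambda>j. E j q) ` I)"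
    "\<And>q i. q \<in> U \<Longrightarrow> i \<in> I \<Longrightarrow> h q (pr q) (E i q) = h q (E k q) (E i q)" by blast
  have "\<exists>w. smooth_vf A U w \<and> (\<forall>q\<in>U. w q \<in> span ((\<lambda>j. E j q) ` I) \<and>
    (\<forall>i\<in>I. h q (w q) (E i q) = \<alpha> i q))"
    using smE indI insert.prems(3) by (intro insert.IH) auto
  then obtain w0 where w0: "smooth_vf A U w0" "\<And>q. q \<in> U \<Longrightarrow> w0 q \<in> span ((\<lambda>j. E j q) ` I)"
    "\<And>q i. q \<in> U \<Longrightarrow> i \<in> I \<Longrightarrow> h q (w0 q) (E i q) = \<alpha> i q" by blast
  \<comment> \<open>The part of \<open>E k\<close> orthogonal to the smaller frame. Independence
    makes it nonzero, so \<open>h (n q) (E k q) = h (n q) (n q)\<close> is positive and may be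
    divided by.\<close>
  define n where "n q = E k q - pr q" for q
  have n: "smooth_vf A U n" unfolding n_def by (intro smooth_vf_diff U smE pr) simp
  note tn = smooth_vf_tspace[OF n] and tpr = smooth_vf_tspace[OF pr(1)]
    and tw0 = smooth_vf_tspace[OF w0(1)]
  have nE: "h q (n q) (E i q) = 0" if "q \<in> U" "i \<in> I" for q i
    using that by (simp add: n_def form_diff_left[OF h] tE tpr pr(3))
  have npr: "h q (n q) (pr q) = 0" if "q \<in> U" for q
    by (rule form_zero_span[OF h _ tn[OF that] _ pr(2)[OF that]]) (use that tE nE in auto)
  have nEk: "h q (n q) (E k q) \<noteq> 0" if "q \<in> U" for q
  proof -
    have "n q \<noteq> 0" using Ek[OF that] pr(2)[OF that] by (auto simp: n_def)
    then have "0 < h q (n q) (n q)" using pos tn that by blast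
    also have "h q (n q) (n q) = h q (n q) (E k q) - h q (n q) (pr q)"
      unfolding n_def[of q] using that
      by (intro form_diff_right[OF h]) (simp_all add: tE tpr tn[unfolded n_def])
    finally show ?thesis using npr that by simp
  qed
  \<comment> \<open>Adding a multiple of \<open>n\<close> does not disturb the equations already
    solved; this multiple makes the equation for \<open>k\<close> hold.\<close>
  define t where "t q = (\<alpha> k q + (-1) * h q (w0 q) (E k q)) / h q (n q) (E k q)" for q
  have t: "smooth_fun A U t"
    unfolding t_def
    by (intro smooth_fun_divide smooth_fun_add smooth_fun_mult smooth_fun_const form_smooth[OF h] U w0
        smE n nEk insert.prems(3)) auto
  have "smooth_vf A U (\<lambda>q. w0 q + t q *\<^sub>R n q)"
    by (intro smooth_vf_add smooth_vf_scale U w0 t n)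
  moreover have "w0 q + t q *\<^sub>R n q \<in> span ((\<lambda>j. E j q) ` insert k I)" if "q \<in> U" for q
  proof -
    have "span ((\<lambda>j. E j q) ` I) \<subseteq> span ((\<lambda>j. E j q) ` insert k I)" by (rule span_mono) auto
    moreover have "E k q \<in> span ((\<lambda>j. E j q) ` insert k I)" by (rule span_base) simp
    ultimately show ?thesis
      unfolding n_def using that pr(2) w0(2) by (intro span_add span_scale span_diff) auto
  qed
  moreover have "h q (w0 q + t q *\<^sub>R n q) (E i q) = \<alpha> i q" if "q \<in> U" "i \<in> insert k I" for q i
  proof -
    have "h q (w0 q + t q *\<^sub>R n q) (E i q) = h q (w0 q) (E i q) + t q * h q (n q) (E i q)"
      using that by (simp add: form_add_left[OF h] form_scale_left[OF h] tw0 tn tE tspace_scale)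
    also have "\<dots> = \<alpha> i q"
      using that nEk[OF that(1)] nE w0(3) by (auto simp: t_def)
    finally show ?thesis .
  qed
  ultimately show ?case by blast
qed

lemma form_represent_chart:
  assumes h: "smooth_bilinear_form h"
    and pos: "\<And>q u. u \<in> tspace A q \<Longrightarrow> u \<noteq> 0 \<Longrightarrow> 0 < h q u u"
    and \<omega>: "smooth_bilinear_form \<omega>"
    and U: "open U" "c \<in> A" "U \<subseteq> cdom c" and X: "smooth_vf A U X"
  shows "\<exists>w. smooth_vf A U w \<and> (\<forall>q\<in>U. \<forall>z\<in>tspace A q. h q (w q) z = \<omega> q (X q) z)"
proof -
  have E: "smooth_vf A U (coord_field A c i)" for i
    using smooth_vf_subset[OF smooth_vf_coord_field] U by blast
  have indep: "coord_field A c i q \<notin> span ((\<lambda>j. coord_field A c j q) ` (Basis - {i}))"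
    if "q \<in> U" "i \<in> Basis" for q i
  proof
    assume *: "coord_field A c i q \<in> span ((\<lambda>j. coord_field A c j q) ` (Basis - {i}))"
    \<comment> \<open>Reading off the component in \<open>c\<close> turns the coordinate fields into
      the standard basis, whose independence is known.\<close>
    have "linear (\<lambda>v. v c :: 'e)" by (auto intro!: linearI simp: scaleR_fun_def)
    from span_linear_image[OF this] *
    have "coord_field A c i q c \<in> span ((\<lambda>v. v c) ` (\<lambda>j. coord_field A c j q) ` (Basis - {i}))"
      by blast
    then have "i \<in> span (Basis - {i})"
      using that U by (simp add: image_image coord_field_same subset_iff)
    with independent_Basis that(2) show False by (auto simp: dependent_def)
  qed
  have sm: "smooth_fun A U (\<lambda>q. \<omega> q (X q) (coord_field A c i q))" for i
    by (intro form_smooth \<omega> U X E)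
  obtain w where w: "smooth_vf A U w"
    "\<And>q i. q \<in> U \<Longrightarrow> i \<in> Basis \<Longrightarrow> h q (w q) (coord_field A c i q) = \<omega> q (X q) (coord_field A c i q)"
    using form_solve_frame[where \<alpha> = "\<lambda>i q. \<omega> q (X q) (coord_field A c i q)",
        OF h pos U(1) finite_Basis E indep sm] by blast
  show ?thesis
  proof (intro exI conjI ballI)
    show "smooth_vf A U w" by (rule w)
    fix q z assume q: "q \<in> U" "z \<in> tspace A q"
    then have qc: "q \<in> cdom c" using U by blast
    have "z = (\<Sum>i\<in>Basis. (z c \<bullet> i) *\<^sub>R coord_field A c i q)"
      using linear_euclidean_expand[OF linear_coord_field[OF U(2) qc]]
        coord_field_component[OF q(2) U(2) qc] by metis
    moreover have "h q (w q) (\<Sum>i\<in>Basis. (z c \<bullet> i) *\<^sub>R coord_field A c i q) =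
        \<omega> q (X q) (\<Sum>i\<in>Basis. (z c \<bullet> i) *\<^sub>R coord_field A c i q)"
      using smooth_vf_tspace[OF w(1) q(1)] smooth_vf_tspace[OF X q(1)] coord_field_in_tspace[OF U(2) qc] q w(2)
      by (simp add: form_sum_right[OF h] form_sum_right[OF \<omega>] form_scale_right[OF h]
          form_scale_right[OF \<omega>] tspace_scale)
    ultimately show "h q (w q) z = \<omega> q (X q) z" by simp
  qed
qed

lemma form_nondegenerate:
  assumes h: "smooth_bilinear_form h"
    and pos: "\<And>u. u \<in> tspace A q \<Longrightarrow> u \<noteq> 0 \<Longrightarrow> 0 < h q u u"
    and "u \<in> tspace A q" "v \<in> tspace A q" "\<And>z. z \<in> tspace A q \<Longrightarrow> h q u z = h q v z"
  shows "u = v"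
proof -
  have "h q (u - v) (u - v) = 0"
    using assms(3-5) by (simp add: form_diff_left[OF h] tspace_diff)
  then show ?thesis
    using pos[of "u - v"] assms(3,4) by (auto simp: tspace_diff)
qed

text \<open>Riesz representation on one tangent space. Existence is read off at \<open>p\<close>
  from the smooth local solution for the coordinate field through \<open>v\<close>; uniqueness is
  what later gives the definite description in \<open>tan_part\<close> a meaning.\<close>

lemma form_represent:
  assumes h: "smooth_bilinear_form h"
    and pos: "\<And>q u. u \<in> tspace A q \<Longrightarrow> u \<noteq> 0 \<Longrightarrow> 0 < h q u u"
    and \<omega>: "smooth_bilinear_form \<omega>" and v: "v \<in> tspace A p"
  shows "\<exists>!w. w \<in> tspace A p \<and> (\<forall>z\<in>tspace A p. h p w z = \<omega> p v z)"
proof (rule ex_ex1I)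
  obtain c where c: "c \<in> A" "p \<in> cdom c" by (rule chart_exists)
  obtain w where w: "smooth_vf A (cdom c) w"
    "\<And>q z. q \<in> cdom c \<Longrightarrow> z \<in> tspace A q \<Longrightarrow> h q (w q) z = \<omega> q (coord_field A c (v c) q) z"
    using form_represent_chart[OF h pos \<omega> open_cdom[OF c(1)] c(1) order.refl smooth_vf_coord_field[OF c(1)]]
    by blast
  show "\<exists>w. w \<in> tspace A p \<and> (\<forall>z\<in>tspace A p. h p w z = \<omega> p v z)"
    using smooth_vf_tspace[OF w(1) c(2)] w(2)[OF c(2)] coord_field_component[OF v c] by auto
  show "w = w'" if "w \<in> tspace A p \<and> (\<forall>z\<in>tspace A p. h p w z = \<omega> p v z)"
    "w' \<in> tspace A p \<and> (\<forall>z\<in>tspace A p. h p w' z = \<omega> p v z)" for w w'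
    using that by (intro form_nondegenerate[OF h pos]) auto
qed

text \<open>A field that is only specified point by point is smooth because, by nondegeneracy, it
  coincides in each chart with the smooth solution found there.\<close>

lemma smooth_vf_represent:
  assumes h: "smooth_bilinear_form h"
    and pos: "\<And>q u. u \<in> tspace A q \<Longrightarrow> u \<noteq> 0 \<Longrightarrow> 0 < h q u u"
    and \<omega>: "smooth_bilinear_form \<omega>" and U: "open U" and X: "smooth_vf A U X"
    and Y: "\<And>q. q \<in> U \<Longrightarrow> Y q \<in> tspace A q"
      "\<And>q z. q \<in> U \<Longrightarrow> z \<in> tspace A q \<Longrightarrow> h q (Y q) z = \<omega> q (X q) z"
  shows "smooth_vf A U Y"
proof (rule smooth_vf_local)
  fix p assume p: "p \<in> U"
  obtain c where c: "c \<in> A" "p \<in> cdom c" by (rule chart_exists)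
  let ?V = "cdom c \<inter> U"
  have V: "open ?V" using U open_cdom[OF c(1)] by blast
  obtain w where w: "smooth_vf A ?V w"
    "\<And>q z. q \<in> ?V \<Longrightarrow> z \<in> tspace A q \<Longrightarrow> h q (w q) z = \<omega> q (X q) z"
    using form_represent_chart[OF h pos \<omega> V c(1) Int_lower1 smooth_vf_subset[OF X Int_lower2]] by blast
  have "smooth_vf A ?V Y"
  proof (rule smooth_vf_cong[OF V _ w(1)])
    fix q assume "q \<in> ?V"
    then show "w q = Y q"
      using w Y smooth_vf_tspace[OF w(1)] by (intro form_nondegenerate[OF h pos]) auto
  qed
  then show "\<exists>V. open V \<and> p \<in> V \<and> smooth_vf A V Y" using V p c by blast
qed

end

section \<open>Maps between manifolds: differential and pullback\<close>

locale smooth_manifold_map = M: smooth_manifold A + N: smooth_manifold B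
  for A :: "('m::{t2_space,second_countable_topology}, 'e::euclidean_space) atlas"
    and B :: "('n::{t2_space,second_countable_topology}, 'f::euclidean_space) atlas" +
  fixes F :: "'m \<Rightarrow> 'n"
  assumes smooth_map: "smooth_map A B F"
begin

abbreviation dF :: "'m \<Rightarrow> ('m, 'e) tvec \<Rightarrow> ('n, 'f) tvec" where
  "dF \<equiv> differential A B F"

lemma open_preimage: "open V \<Longrightarrow> open (F -` V)"
  using smooth_map by (auto simp: smooth_map_def intro: open_vimage)

lemma smooth_fun_cmap_map: "d \<in> B \<Longrightarrow> smooth_fun A (F -` cdom d) (\<lambda>q. cmap d (F q))"
  using smooth_map unfolding smooth_map_def smooth_fun_def o_def by blast

lemma smooth_fun_pullback:
  assumes "open W" "smooth_fun B W h"
  shows "smooth_fun A (F -` W) (\<lambda>q. h (F q))"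
proof (rule M.smooth_fun_local)
  fix p assume p: "p \<in> F -` W"
  obtain d where d: "d \<in> B" "F p \<in> cdom d" by (rule N.chart_exists)
  let ?W = "cdom d \<inter> W"
  have W: "open ?W" using assms(1) N.open_cdom[OF d(1)] by blast
  have "smooth_fun A (F -` ?W) (\<lambda>q. h (cinv d (cmap d (F q))))"
    by (rule M.smooth_fun_compose[OF open_preimage[OF W] N.open_chart_image[OF d(1) assms(1)]
          M.smooth_fun_subset[OF smooth_fun_cmap_map[OF d(1)]] N.smooth_funD[OF assms(2) d(1)]])
      auto
  then have "smooth_fun A (F -` ?W) (\<lambda>q. h (F q))"
    by (rule M.smooth_fun_cong[OF open_preimage[OF W], rotated]) (simp add: N.cinv_cmap[OF d(1)])
  then show "\<exists>V. open V \<and> p \<in> V \<and> smooth_fun A V (\<lambda>q. h (F q))"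
    using p d open_preimage[OF W] by blast
qed

lemma differential_apply:
  "d \<in> B \<Longrightarrow> F p \<in> cdom d \<Longrightarrow> dF p v d = dirderiv A p v (\<lambda>q. cmap d (F q))"
  by (simp add: differential_def o_def)

lemma dirderiv_pullback_chart:
  assumes W: "open W" "smooth_fun B W h" "F p \<in> W" and d: "d \<in> B" "F p \<in> cdom d"
  shows "dirderiv A p v (\<lambda>q. h (F q)) =
    frechet_derivative (\<lambda>y. h (cinv d y)) (at (cmap d (F p))) (dF p v d)"
proof -
  let ?c = "chart_at A p" let ?V = "F -` (cdom d \<inter> W)"
  note c = M.chart_at[of p]
  have V: "open ?V" using W(1) N.open_cdom[OF d(1)] by (intro open_preimage) blast
  have "(\<lambda>x. cmap d (F (cinv ?c x))) differentiable (at (cmap ?c p))"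
    using d by (intro M.smooth_fun_differentiable[OF smooth_fun_cmap_map[OF d(1)]] c) auto
  moreover have "(\<lambda>y. h (cinv d y)) differentiable (at (cmap d (F (cinv ?c (cmap ?c p)))))"
    using N.smooth_fun_differentiable[OF W(2,3) d] by (simp add: M.cinv_cmap c)
  ultimately have "((\<lambda>x. h (cinv d (cmap d (F (cinv ?c x))))) has_derivative
     (\<lambda>w. frechet_derivative (\<lambda>y. h (cinv d y)) (at (cmap d (F (cinv ?c (cmap ?c p)))))
       (frechet_derivative (\<lambda>x. cmap d (F (cinv ?c x))) (at (cmap ?c p)) w))) (at (cmap ?c p))"
    unfolding frechet_derivative_works by (rule has_derivative_compose)
  from frechet_derivative_eq[OF this]
  have "dirderiv A p v (\<lambda>q. h (cinv d (cmap d (F q)))) =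
      frechet_derivative (\<lambda>y. h (cinv d y)) (at (cmap d (F p))) (dF p v d)"
    using d by (simp add: differential_apply dirderiv_def Let_def o_def M.cinv_cmap c)
  moreover have "dirderiv A p v (\<lambda>q. h (cinv d (cmap d (F q)))) = dirderiv A p v (\<lambda>q. h (F q))"
    by (rule M.dirderiv_cong[OF V]) (use d W in \<open>simp_all add: N.cinv_cmap\<close>)
  ultimately show ?thesis by simp
qed

text \<open>The chain rule with a second chart map as the function is the transformation law.
  Nothing is asked of \<open>v\<close>, since \<open>dirderiv\<close> reads only its component in
  the chosen chart.\<close>

lemma differential_in_tspace: "dF p v \<in> tspace B (F p)"
proof (rule N.tspaceI)
  fix d d' assume d: "d \<in> B" "d' \<in> B" "F p \<in> cdom d" "F p \<in> cdom d'"
  show "dF p v d' = frechet_derivative (\<lambda>x. cmap d' (cinv d x)) (at (cmap d (F p))) (dF p v d)"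
    using dirderiv_pullback_chart[OF N.open_cdom[OF d(2)] N.smooth_fun_cmap[OF d(2)] d(4,1,3)] d
    by (simp add: differential_apply)
qed (auto simp: differential_def)

lemma dirderiv_pullback:
  assumes "open W" "smooth_fun B W h" "F p \<in> W"
  shows "dirderiv A p v (\<lambda>q. h (F q)) = dirderiv B (F p) (dF p v) h"
proof -
  obtain d where d: "d \<in> B" "F p \<in> cdom d" by (rule N.chart_exists)
  show ?thesis
    using dirderiv_pullback_chart[OF assms d] N.dirderiv_chart[OF assms differential_in_tspace d] by simp
qed

lemma linear_differential: "linear (dF p)"
proof -
  have "linear (\<lambda>v. dF p v d)" for d
  proof (cases "d \<in> B \<and> F p \<in> cdom d")
    case True
    then have "linear (\<lambda>v. dirderiv A p v (\<lambda>q. cmap d (F q)))"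
      by (intro M.linear_dirderiv[OF smooth_fun_cmap_map]) auto
    with True show ?thesis by (simp add: differential_apply)
  next
    case False
    then have "(\<lambda>v. dF p v d) = (\<lambda>_. 0)" by (auto simp: differential_def)
    then show ?thesis by (simp add: linear_iff)
  qed
  then show ?thesis
    by (auto simp: linear_iff fun_eq_iff scaleR_fun_def)
qed

lemma smooth_fun_differential:
  assumes "open U" "d \<in> B" "U \<subseteq> F -` cdom d" "smooth_vf A U X"
  shows "smooth_fun A U (\<lambda>q. dF q (X q) d)"
  by (rule M.smooth_fun_cong[OF assms(1) _ M.smooth_fun_dirderiv[OF assms(1)
          M.smooth_fun_subset[OF smooth_fun_cmap_map[OF assms(2)] assms(3)] assms(4)]])
    (use assms in \<open>auto simp: differential_apply\<close>)

lemma smooth_bilinear_form_pullback: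
  assumes b: "N.smooth_bilinear_form b"
  shows "M.smooth_bilinear_form (\<lambda>p u v. b (F p) (dF p u) (dF p v))"
  unfolding M.smooth_bilinear_form_def
proof (intro conjI allI ballI impI)
  fix U X Y assume U: "open U" and X: "smooth_vf A U X" and Y: "smooth_vf A U Y"
  show "smooth_fun A U (\<lambda>p. b (F p) (dF p (X p)) (dF p (Y p)))"
  proof (rule M.smooth_fun_local)
    fix p assume p: "p \<in> U"
    obtain d where d: "d \<in> B" "F p \<in> cdom d" by (rule N.chart_exists)
    let ?V = "F -` cdom d \<inter> U"
    have V: "open ?V" using U open_preimage[OF N.open_cdom[OF d(1)]] by blast
    \<comment> \<open>Smoothness of \<open>b\<close> is known for ambient vector fields only, and
      \<open>dF X\<close> is none. In coordinates the coefficients are smooth functions on the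
      source, while \<open>b\<close> meets only ambient coordinate fields.\<close>
    have "smooth_fun A ?V (\<lambda>q. \<Sum>i\<in>Basis. \<Sum>j\<in>Basis. (dF q (X q) d \<bullet> i) * (dF q (Y q) d \<bullet> j) *
        b (F q) (coord_field B d i (F q)) (coord_field B d j (F q)))"
      by (intro M.smooth_fun_sum M.smooth_fun_mult M.smooth_fun_inner M.smooth_fun_const V
          smooth_fun_differential d Int_lower1 M.smooth_vf_subset[OF X] M.smooth_vf_subset[OF Y] Int_lower2
          M.smooth_fun_subset[OF smooth_fun_pullback[OF N.open_cdom[OF d(1)]
            N.form_smooth[OF b N.open_cdom N.smooth_vf_coord_field N.smooth_vf_coord_field]]])
    then have "smooth_fun A ?V (\<lambda>p. b (F p) (dF p (X p)) (dF p (Y p)))"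
      by (rule M.smooth_fun_cong[OF V, rotated])
        (simp add: N.form_chart_expand[OF b d(1) _ differential_in_tspace differential_in_tspace])
    then show "\<exists>V. open V \<and> p \<in> V \<and> smooth_fun A V (\<lambda>p. b (F p) (dF p (X p)) (dF p (Y p)))"
      using V p d by blast
  qed
qed (simp_all add: linear_add[OF linear_differential] linear_cmul[OF linear_differential]
    N.form_add_left[OF b] N.form_add_right[OF b] N.form_scale_left[OF b] N.form_scale_right[OF b]
    differential_in_tspace)

end

section \<open>Connections and totally geodesic submanifolds\<close>

context smooth_manifold
begin

lemma levi_civita_torsion_free:
  "levi_civita A g nabla \<Longrightarrow> open U \<Longrightarrow> smooth_vf A U X \<Longrightarrow> smooth_vf A U Y \<Longrightarrow> p \<in> U \<Longrightarrow>
    lie_bracket A X Y p = nabla X Y p - nabla Y X p"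
  by (simp add: levi_civita_def)

lemma levi_civita_metric:
  "levi_civita A g nabla \<Longrightarrow> open U \<Longrightarrow> smooth_vf A U X \<Longrightarrow> smooth_vf A U Y \<Longrightarrow> smooth_vf A U Z \<Longrightarrow>
    p \<in> U \<Longrightarrow>
    dirderiv A p (X p) (\<lambda>q. g q (Y q) (Z q)) = g p (nabla X Y p) (Z p) + g p (Y p) (nabla X Z p)"
  by (simp add: levi_civita_def)

context
  fixes nabla :: "('m, 'e) connection"
  assumes conn: "affine_connection A nabla"
begin

lemma connection_smooth:
  "open U \<Longrightarrow> smooth_vf A U X \<Longrightarrow> smooth_vf A U Y \<Longrightarrow> smooth_vf A U (nabla X Y)"
  using conn by (simp add: affine_connection_def)

lemma connection_add:
  "open U \<Longrightarrow> smooth_vf A U X \<Longrightarrow> smooth_vf A U Y \<Longrightarrow> smooth_vf A U Y' \<Longrightarrow> p \<in> U \<Longrightarrow>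
    nabla X (\<lambda>q. Y q + Y' q) p = nabla X Y p + nabla X Y' p"
  using conn by (simp add: affine_connection_def)

lemma connection_Leibniz:
  "open U \<Longrightarrow> smooth_fun A U f \<Longrightarrow> smooth_vf A U X \<Longrightarrow> smooth_vf A U Y \<Longrightarrow> p \<in> U \<Longrightarrow>
    nabla X (\<lambda>q. f q *\<^sub>R Y q) p = dirderiv A p (X p) f *\<^sub>R Y p + f p *\<^sub>R nabla X Y p"
  using conn by (simp add: affine_connection_def)

lemma connection_scale:
  "open U \<Longrightarrow> smooth_vf A U X \<Longrightarrow> smooth_vf A U Y \<Longrightarrow> p \<in> U \<Longrightarrow>
    nabla X (\<lambda>q. a *\<^sub>R Y q) p = a *\<^sub>R nabla X Y p"
  using connection_Leibniz[OF _ smooth_fun_const, of U X Y p a] by (simp add: dirderiv_const)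

text \<open>A connection takes total functions as arguments, but identities such as additivity of
  \<open>coord_field\<close> in its direction hold only on the chart domain.\<close>

lemma connection_cong:
  assumes U: "open U" "p \<in> U" and X: "smooth_vf A U X" and Y: "smooth_vf A U Y"
    and eq: "\<And>q. q \<in> U \<Longrightarrow> Y q = Y' q"
  shows "nabla X Y p = nabla X Y' p"
proof -
  define Z where "Z q = Y' q - Y q" for q
  \<comment> \<open>The difference \<open>Z\<close> vanishes on \<open>U\<close>, so multiplying by
    this indicator leaves \<open>Z\<close> unchanged as a total function. Both terms of the Leibniz
    rule are 0 at \<open>p\<close>, the first since \<open>Z p = 0\<close>, the second since
    \<open>f p = 0\<close>.\<close>
  define f :: "'m \<Rightarrow> real" where "f q = (if q \<in> U then 0 else 1)" for q
  have Z: "smooth_vf A U Z"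
    by (rule smooth_vf_cong[OF U(1) _ smooth_vf_zero]) (simp add: Z_def eq)
  have f: "smooth_fun A U f"
    by (rule smooth_fun_cong[OF U(1) _ smooth_fun_const[of _ 0]]) (simp add: f_def)
  have "(\<lambda>q. f q *\<^sub>R Z q) = Z"
    by (rule ext) (simp add: f_def Z_def eq)
  then have "nabla X Z p = 0"
    using connection_Leibniz[OF U(1) f X Z U(2)] U(2) by (simp add: f_def Z_def eq)
  moreover have "Y' = (\<lambda>q. Y q + Z q)" by (simp add: Z_def)
  ultimately show ?thesis
    using connection_add[OF U(1) X Y Z U(2)] by simp
qed

text \<open>Constant coefficients produce no derivative term in the Leibniz rule; this is the
  linearity of the Christoffel symbols in their second argument.\<close>

lemma linear_connection_coord_field:
  assumes d: "d \<in> A" "p \<in> cdom d"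
  shows "linear (\<lambda>w. nabla (coord_field A d u) (coord_field A d w) p)"
proof (rule linearI)
  note U = open_cdom[OF d(1)] and c = smooth_vf_coord_field[OF d(1)]
  show "nabla (coord_field A d u) (coord_field A d (w + w')) p =
      nabla (coord_field A d u) (coord_field A d w) p + nabla (coord_field A d u) (coord_field A d w') p"
    for w w'
    using connection_cong[OF U d(2) c c, of "w + w'" "\<lambda>q. coord_field A d w q + coord_field A d w' q" u]
      connection_add[OF U c c c d(2)]
    by (simp add: linear_add[OF linear_coord_field[OF d(1)]])
  show "nabla (coord_field A d u) (coord_field A d (a *\<^sub>R w)) p =
      a *\<^sub>R nabla (coord_field A d u) (coord_field A d w) p" for a w
    using connection_cong[OF U d(2) c c, of "a *\<^sub>R w" "\<lambda>q. a *\<^sub>R coord_field A d w q" u]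
      connection_scale[OF U c c d(2)]
    by (simp add: linear_cmul[OF linear_coord_field[OF d(1)]])
qed

end

end

context smooth_manifold_map
begin

text \<open>After expansion in coordinate fields, the derivative falls on the coefficients, which
  live on the source, and on the matrix of \<open>b\<close>, where \<open>parallel\<close> applies
  to ambient fields. That the covariant derivatives are tangent vectors is a hypothesis: this avoids
  the transformation law of Christoffel symbols, and in the totally geodesic case they are images
  under \<open>dF\<close> anyway.\<close>

lemma dirderiv_parallel_form:
  assumes b: "N.smooth_bilinear_form b" and conn: "affine_connection B nab"
    and parallel: "\<And>U X Y Z p. open U \<Longrightarrow> smooth_vf B U X \<Longrightarrow> smooth_vf B U Y \<Longrightarrow> smooth_vf B U Z \<Longrightarrow>
      p \<in> U \<Longrightarrow> dirderiv B p (X p) (\<lambda>q. b q (Y q) (Z q)) =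
        b p (nab X Y p) (Z p) + b p (Y p) (nab X Z p)"
    and Y: "smooth_vf A UNIV Y" and Z: "smooth_vf A UNIV Z"
    and covY: "cov_along A B F nab p v (\<lambda>q. dF q (Y q)) \<in> tspace B (F p)"
    and covZ: "cov_along A B F nab p v (\<lambda>q. dF q (Z q)) \<in> tspace B (F p)"
  shows "dirderiv A p v (\<lambda>q. b (F q) (dF q (Y q)) (dF q (Z q))) =
    b (F p) (cov_along A B F nab p v (\<lambda>q. dF q (Y q))) (dF p (Z p)) +
    b (F p) (dF p (Y p)) (cov_along A B F nab p v (\<lambda>q. dF q (Z q)))"
proof -
  obtain d where d: "d \<in> B" "F p \<in> cdom d" by (rule N.chart_exists)
  define C where "C w = coord_field B d w" for w
  define y where "y q = dF q (Y q) d" for q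
  define z where "z q = dF q (Z q) d" for q
  define Dy where "Dy = dirderiv A p v y"
  define Dz where "Dz = dirderiv A p v z"
  define \<Gamma> where "\<Gamma> w = nab (C (dF p v d)) (C w) (F p)" for w
  define \<omega> where "\<omega> i j q = b q (C i q) (C j q)" for i j q
  let ?U = "F -` cdom d"
  note oB = N.open_cdom[OF d(1)]
  have o: "open ?U" by (rule open_preimage[OF oB])
  have p: "p \<in> ?U" using d by simp
  have C: "smooth_vf B (cdom d) (C w)" for w unfolding C_def by (rule N.smooth_vf_coord_field[OF d(1)])
  have Ct: "C w (F p) \<in> tspace B (F p)" for w
    using N.smooth_vf_tspace[OF C d(2)] .
  have Cl: "linear (\<lambda>w. C w (F p))" unfolding C_def by (rule N.linear_coord_field[OF d])
  have \<Gamma>t: "\<Gamma> w \<in> tspace B (F p)" for w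
    unfolding \<Gamma>_def by (rule N.smooth_vf_tspace[OF N.connection_smooth[OF conn oB C C] d(2)])
  have \<Gamma>l: "linear \<Gamma>"
    unfolding \<Gamma>_def C_def by (rule N.linear_connection_coord_field[OF conn d])
  have ysm: "smooth_fun A ?U y" and zsm: "smooth_fun A ?U z"
    unfolding y_def z_def
    by (intro smooth_fun_differential o d order.refl M.smooth_vf_subset[OF Y]
        M.smooth_vf_subset[OF Z] subset_UNIV)+
  have \<omega>sm: "smooth_fun B (cdom d) (\<omega> i j)" for i j
    unfolding \<omega>_def by (intro N.form_smooth b oB C)
  have \<omega>F: "smooth_fun A ?U (\<lambda>q. \<omega> i j (F q))" for i j
    by (rule smooth_fun_pullback[OF oB \<omega>sm])
  have Cy: "C (y p) (F p) = dF p (Y p)" and Cz: "C (z p) (F p) = dF p (Z p)"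
    and Cv: "C (dF p v d) (F p) = dF p v"
    unfolding C_def y_def z_def using N.coord_field_component[OF differential_in_tspace d] by auto
  \<comment> \<open>Since both sides are tangent vectors, comparing them in the single chart
    \<open>d\<close> is enough.\<close>
  have cov: "cov_along A B F nab p v (\<lambda>q. dF q (V q)) =
      C (dirderiv A p v (\<lambda>q. dF q (V q) d)) (F p) + \<Gamma> (dF p (V p) d)"
    if "cov_along A B F nab p v (\<lambda>q. dF q (V q)) \<in> tspace B (F p)" for V
    using d by (intro N.tspace_eqI[OF that N.tspace_add[OF Ct \<Gamma>t] d])
      (simp add: cov_along_def christoffel_def \<Gamma>_def C_def N.coord_field_same)
  \<comment> \<open>The derivative along \<open>v\<close> of a pulled-back function is the ambient
    one along \<open>dF p v\<close>, which is the value at \<open>F p\<close> of a coordinate field,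
    as \<open>parallel\<close> requires.\<close>
  have D\<omega>: "dirderiv A p v (\<lambda>q. \<omega> i j (F q)) =
      b (F p) (\<Gamma> i) (C j (F p)) + b (F p) (C i (F p)) (\<Gamma> j)" for i j
    using parallel[OF oB C C C d(2), of "dF p v d" i j] dirderiv_pullback[OF oB \<omega>sm d(2), of v i j]
    by (simp add: Cv \<omega>_def[abs_def] \<Gamma>_def)
  have yi: "smooth_fun A ?U (\<lambda>q. y q \<bullet> i)" and zi: "smooth_fun A ?U (\<lambda>q. z q \<bullet> i)" for i
    by (intro M.smooth_fun_inner o ysm zsm M.smooth_fun_const)+
  have yz: "smooth_fun A ?U (\<lambda>q. (y q \<bullet> i) * (z q \<bullet> j))" for i j
    by (intro M.smooth_fun_mult o yi zi)
  have Di: "dirderiv A p v (\<lambda>q. y q \<bullet> i) = Dy \<bullet> i" "dirderiv A p v (\<lambda>q. z q \<bullet> i) = Dz \<bullet> i" for i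
    using M.dirderiv_inner[OF ysm M.smooth_fun_const p] M.dirderiv_inner[OF zsm M.smooth_fun_const p]
    by (simp_all add: Dy_def Dz_def M.dirderiv_const)
  have summand: "dirderiv A p v (\<lambda>q. (y q \<bullet> i) * (z q \<bullet> j) * \<omega> i j (F q)) =
      (Dy \<bullet> i) * (z p \<bullet> j) * b (F p) (C i (F p)) (C j (F p)) +
      (y p \<bullet> i) * (Dz \<bullet> j) * b (F p) (C i (F p)) (C j (F p)) +
      ((y p \<bullet> i) * (z p \<bullet> j) * b (F p) (\<Gamma> i) (C j (F p)) +
      (y p \<bullet> i) * (z p \<bullet> j) * b (F p) (C i (F p)) (\<Gamma> j))" for i j
    unfolding M.dirderiv_mult[OF yz \<omega>F p] M.dirderiv_mult[OF yi zi p] Di D\<omega>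
    by (simp add: \<omega>_def algebra_simps)
  have "dirderiv A p v (\<lambda>q. b (F q) (dF q (Y q)) (dF q (Z q))) =
      dirderiv A p v (\<lambda>q. \<Sum>i\<in>Basis. \<Sum>j\<in>Basis. (y q \<bullet> i) * (z q \<bullet> j) * \<omega> i j (F q))"
    by (rule M.dirderiv_cong[OF o p])
      (simp add: N.form_chart_expand[OF b d(1) _ differential_in_tspace differential_in_tspace]
        y_def z_def \<omega>_def C_def)
  also have "\<dots> = (\<Sum>i\<in>Basis. \<Sum>j\<in>Basis. dirderiv A p v (\<lambda>q. (y q \<bullet> i) * (z q \<bullet> j) * \<omega> i j (F q)))"
  proof -
    have sm: "smooth_fun A ?U (\<lambda>q. (y q \<bullet> i) * (z q \<bullet> j) * \<omega> i j (F q))" for i j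
      by (intro M.smooth_fun_mult[OF o] yz \<omega>F)
    show ?thesis
      by (simp only: M.dirderiv_sum[OF M.smooth_fun_sum[OF o sm] p] M.dirderiv_sum[OF sm p])
  qed
  \<comment> \<open>Each of the four double sums is a bilinear expansion read backwards; for those
    with \<open>\<Gamma>\<close> this uses its linearity.\<close>
  also have "\<dots> = b (F p) (C Dy (F p)) (C (z p) (F p)) + b (F p) (C (y p) (F p)) (C Dz (F p)) +
      (b (F p) (\<Gamma> (y p)) (C (z p) (F p)) + b (F p) (C (y p) (F p)) (\<Gamma> (z p)))"
    unfolding summand sum.distrib
    by (simp only: N.form_expand[OF b Cl Cl Ct Ct, of Dy "z p"]
        N.form_expand[OF b Cl Cl Ct Ct, of "y p" Dz]
        N.form_expand[OF b Cl \<Gamma>l Ct \<Gamma>t, of "y p" "z p"]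
        N.form_expand[OF b \<Gamma>l Cl \<Gamma>t Ct, of "y p" "z p"])
  also have "\<dots> = b (F p) (C Dy (F p) + \<Gamma> (y p)) (C (z p) (F p)) +
      b (F p) (C (y p) (F p)) (C Dz (F p) + \<Gamma> (z p))"
    by (simp add: N.form_add_left[OF b] N.form_add_right[OF b] Ct \<Gamma>t)
  also have "C Dy (F p) + \<Gamma> (y p) = cov_along A B F nab p v (\<lambda>q. dF q (Y q))"
    using cov[OF covY] by (simp add: Dy_def y_def [abs_def])
  also have "C Dz (F p) + \<Gamma> (z p) = cov_along A B F nab p v (\<lambda>q. dF q (Z q))"
    using cov[OF covZ] by (simp add: Dz_def z_def [abs_def])
  finally show ?thesis by (simp only: Cy Cz)
qed

end

locale totally_geodesic_submanifold = smooth_manifold_map A B F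
  for A :: "('m::{t2_space,second_countable_topology}, 'e::euclidean_space) atlas"
    and B :: "('n::{t2_space,second_countable_topology}, 'f::euclidean_space) atlas"
    and F :: "'m \<Rightarrow> 'n" +
  fixes \<phi> :: "('n, 'f) endo" and g :: "('n, 'f) metric"
    and nablab :: "('n, 'f) connection" and nabla :: "('m, 'e) connection"
  assumes kaehler: "kaehler B \<phi> g nablab"
    and immersion: "injective_immersion A B F"
    and levi_civita: "levi_civita A (induced_metric A B F g) nabla"
    and totally_geodesic: "totally_geodesic A B F nablab nabla"
begin

abbreviation h :: "('m, 'e) metric" where
  "h \<equiv> induced_metric A B F g"

abbreviation T :: "('m, 'e) endo" where
  "T \<equiv> tan_part A B F \<phi> g"

definition \<omega> :: "('m, 'e) metric" where
  "\<omega> p u v = g (F p) (\<phi> (F p) (dF p u)) (dF p v)"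

section \<open>The ambient Kaehler structure\<close>

lemma almost_hermitian: "almost_hermitian B \<phi> g"
  using kaehler by (simp add: kaehler_def)

lemma riemannian: "riemannian_metric B g"
  using almost_hermitian by (simp add: almost_hermitian_def)

lemma levi_civita_ambient: "levi_civita B g nablab"
  using kaehler by (simp add: kaehler_def)

lemma connection: "affine_connection A nabla"
  using levi_civita by (simp add: levi_civita_def)

lemma connection_ambient: "affine_connection B nablab"
  using levi_civita_ambient by (simp add: levi_civita_def)

lemma phi_tspace: "v \<in> tspace B p \<Longrightarrow> \<phi> p v \<in> tspace B p"
  using almost_hermitian by (simp add: almost_hermitian_def)

lemma phi_phi: "v \<in> tspace B p \<Longrightarrow> \<phi> p (\<phi> p v) = - v"
  using almost_hermitian by (simp add: almost_hermitian_def)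

lemma g_phi_phi: "u \<in> tspace B p \<Longrightarrow> v \<in> tspace B p \<Longrightarrow> g p (\<phi> p u) (\<phi> p v) = g p u v"
  using almost_hermitian by (simp add: almost_hermitian_def)

lemma phi_comb:
  "u \<in> tspace B p \<Longrightarrow> v \<in> tspace B p \<Longrightarrow> \<phi> p (a *\<^sub>R u + v) = a *\<^sub>R \<phi> p u + \<phi> p v"
  using almost_hermitian by (simp add: almost_hermitian_def)

lemma phi_add: "u \<in> tspace B p \<Longrightarrow> v \<in> tspace B p \<Longrightarrow> \<phi> p (u + v) = \<phi> p u + \<phi> p v"
  using phi_comb[of u p v 1] by simp

lemma phi_0: "\<phi> p 0 = 0"
  using phi_add[of 0 p 0] by (simp add: N.tspace_0)

lemma phi_scale: "u \<in> tspace B p \<Longrightarrow> \<phi> p (a *\<^sub>R u) = a *\<^sub>R \<phi> p u"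
  using phi_comb[of u p 0 a] by (simp add: N.tspace_0 phi_0)

lemma phi_smooth: "open U \<Longrightarrow> smooth_vf B U X \<Longrightarrow> smooth_vf B U (\<lambda>p. \<phi> p (X p))"
  using almost_hermitian by (simp add: almost_hermitian_def)

lemma g_sym: "u \<in> tspace B p \<Longrightarrow> v \<in> tspace B p \<Longrightarrow> g p u v = g p v u"
  using riemannian by (simp add: riemannian_metric_def)

lemma g_pos: "u \<in> tspace B p \<Longrightarrow> u \<noteq> 0 \<Longrightarrow> 0 < g p u u"
  using riemannian by (simp add: riemannian_metric_def)

lemma form_g: "N.smooth_bilinear_form g"
proof -
  have c: "g p (a *\<^sub>R u + v) w = a * g p u w + g p v w"
    if "u \<in> tspace B p" "v \<in> tspace B p" "w \<in> tspace B p" for p u v w a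
    using riemannian that by (simp add: riemannian_metric_def)
  have a: "g p (u + v) w = g p u w + g p v w"
    if "u \<in> tspace B p" "v \<in> tspace B p" "w \<in> tspace B p" for p u v w
    using c[of u p v w 1] that by simp
  have z: "g p 0 w = 0" if "w \<in> tspace B p" for p w
    using a[of 0 p 0 w] that by (simp add: N.tspace_0)
  have s: "g p (a *\<^sub>R u) w = a * g p u w" if "u \<in> tspace B p" "w \<in> tspace B p" for p u w a
    using c[of u p 0 w a] z that by (simp add: N.tspace_0)
  have sm: "smooth_fun B U (\<lambda>p. g p (X p) (Y p))"
    if "open U" "smooth_vf B U X" "smooth_vf B U Y" for U X Y
    using riemannian that by (simp add: riemannian_metric_def)
  show ?thesis
    unfolding N.smooth_bilinear_form_def
  proof (intro conjI allI ballI impI)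
    fix p u v w assume uvw: "u \<in> tspace B p" "v \<in> tspace B p" "w \<in> tspace B p"
    then show "g p (u + v) w = g p u w + g p v w" by (rule a)
    show "g p w (u + v) = g p w u + g p w v"
      using uvw a by (simp add: g_sym[of w] N.tspace_add)
  next
    fix p u w a assume uw: "u \<in> tspace B p" "w \<in> tspace B p"
    then show "g p (a *\<^sub>R u) w = a * g p u w" by (rule s)
    show "g p w (a *\<^sub>R u) = a * g p w u"
      using uw s by (simp add: g_sym[of w] N.tspace_scale)
  qed (rule sm)
qed

lemma form_kaehler: "N.smooth_bilinear_form (\<lambda>p u v. g p (\<phi> p u) v)"
  unfolding N.smooth_bilinear_form_def
  by (auto simp: phi_add phi_scale phi_tspace N.form_add_left[OF form_g] N.form_add_right[OF form_g]
      N.form_scale_left[OF form_g] N.form_scale_right[OF form_g]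
      intro!: N.form_smooth[OF form_g] phi_smooth)

section \<open>The induced metric and the tangential part of \<phi>\<close>

lemma form_h: "M.smooth_bilinear_form h"
  using smooth_bilinear_form_pullback[OF form_g] by (simp add: induced_metric_def[abs_def])

lemma form_\<omega>: "M.smooth_bilinear_form \<omega>"
  using smooth_bilinear_form_pullback[OF form_kaehler] by (simp add: \<omega>_def[abs_def])

lemma differential_inject:
  "u \<in> tspace A p \<Longrightarrow> v \<in> tspace A p \<Longrightarrow> dF p u = dF p v \<Longrightarrow> u = v"
  using immersion by (auto simp: injective_immersion_def inj_on_def)

lemma h_sym: "h p u v = h p v u"
  unfolding induced_metric_def by (rule g_sym) (rule differential_in_tspace)+

lemma h_pos: "u \<in> tspace A p \<Longrightarrow> u \<noteq> 0 \<Longrightarrow> 0 < h p u u"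
  using differential_inject[of u p 0] linear_0[OF linear_differential[of p]]
  by (auto simp: induced_metric_def M.tspace_0 intro!: g_pos differential_in_tspace)

lemma h_nonneg: "u \<in> tspace A p \<Longrightarrow> 0 \<le> h p u u"
  using h_pos[of u p] M.form_zero_left[OF form_h, of 0 p] by (cases "u = 0") (auto simp: M.tspace_0)

text \<open>That \<open>\<phi> (dF v) - dF w\<close> is normal says exactly that \<open>w\<close>
  represents \<open>\<omega> v\<close> with respect to \<open>h\<close>, so the Riesz representation
  justifies the definite description.\<close>

lemma tan_part:
  assumes v: "v \<in> tspace A p"
  shows tan_part_tspace: "T p v \<in> tspace A p"
    and h_tan_part: "\<And>z. z \<in> tspace A p \<Longrightarrow> h p (T p v) z = \<omega> p v z"
proof -
  have eq: "g (F p) (\<phi> (F p) (dF p v) - dF p w) (dF p z) = 0 \<longleftrightarrow> h p w z = \<omega> p v z" for w z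
    by (subst N.form_diff_left[OF form_g])
      (auto simp: induced_metric_def \<omega>_def intro!: phi_tspace differential_in_tspace)
  have "\<exists>!w. w \<in> tspace A p \<and> (\<forall>z\<in>tspace A p. h p w z = \<omega> p v z)"
    by (rule M.form_represent[OF form_h h_pos form_\<omega> v])
  from theI'[OF this] show "T p v \<in> tspace A p"
    "\<And>z. z \<in> tspace A p \<Longrightarrow> h p (T p v) z = \<omega> p v z"
    unfolding tan_part_def eq by auto
qed

lemma tan_part_unique:
  assumes "v \<in> tspace A p" "w \<in> tspace A p" "\<And>z. z \<in> tspace A p \<Longrightarrow> h p w z = \<omega> p v z"
  shows "T p v = w"
  by (rule M.form_nondegenerate[OF form_h h_pos]) (use assms tan_part in auto)

lemma tan_part_add:
  assumes "u \<in> tspace A p" "v \<in> tspace A p"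
  shows "T p (u + v) = T p u + T p v"
  using assms
  by (intro tan_part_unique)
    (simp_all add: M.tspace_add tan_part M.form_add_left[OF form_h] M.form_add_left[OF form_\<omega>])

lemma tan_part_scale:
  assumes "u \<in> tspace A p"
  shows "T p (a *\<^sub>R u) = a *\<^sub>R T p u"
  using assms
  by (intro tan_part_unique)
    (simp_all add: M.tspace_scale tan_part M.form_scale_left[OF form_h] M.form_scale_left[OF form_\<omega>])

lemma tan_part_0: "T p 0 = 0"
  using tan_part_scale[of 0 p 0] by (simp add: M.tspace_0)

lemma tan_part_diff:
  assumes "u \<in> tspace A p" "v \<in> tspace A p"
  shows "T p (u - v) = T p u - T p v"
  using tan_part_add[of "u - v" p v] assms by (simp add: M.tspace_diff)

lemma tan_part_sum:
  "(\<And>i. i \<in> I \<Longrightarrow> x i \<in> tspace A p) \<Longrightarrow> T p (\<Sum>i\<in>I. x i) = (\<Sum>i\<in>I. T p (x i))"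
  by (induction I rule: infinite_finite_induct)
    (simp_all add: tan_part_0 tan_part_add subspace_sum[OF M.subspace_tspace])

text \<open>Since \<phi> is an isometry with square -1, \<open>g (\<phi> u) v = g (\<phi> (\<phi>
  u)) (\<phi> v) = - g u (\<phi> v)\<close>.\<close>

lemma tan_part_skew:
  assumes "u \<in> tspace A p" "v \<in> tspace A p"
  shows "h p (T p u) v = - h p u (T p v)"
proof -
  note t = differential_in_tspace[of p]
  have "\<omega> p u v = g (F p) (\<phi> (F p) (\<phi> (F p) (dF p u))) (\<phi> (F p) (dF p v))"
    unfolding \<omega>_def by (intro g_phi_phi[symmetric] phi_tspace t)
  also have "\<dots> = g (F p) ((-1) *\<^sub>R dF p u) (\<phi> (F p) (dF p v))"
    by (simp add: phi_phi t)
  also have "\<dots> = - g (F p) (dF p u) (\<phi> (F p) (dF p v))"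
    by (subst N.form_scale_left[OF form_g]) (simp_all add: t phi_tspace)
  also have "\<dots> = - \<omega> p v u"
    unfolding \<omega>_def by (simp add: g_sym t phi_tspace)
  finally have "\<omega> p u v = - \<omega> p v u" .
  then show ?thesis using assms by (simp add: tan_part h_sym[of p u])
qed

lemma smooth_vf_tan_part: "smooth_vf A UNIV X \<Longrightarrow> smooth_vf A UNIV (\<lambda>q. T q (X q))"
  by (rule M.smooth_vf_represent[OF form_h h_pos form_\<omega> open_UNIV])
    (auto intro: tan_part dest: M.smooth_vf_tspace)

text \<open>The function \<open>\<omega> Y Z = h (T Y) Z\<close> is differentiated along
  \<open>X\<close> in two ways, by parallelism of \<omega> and by metric compatibility of
  \<open>nabla\<close>. The terms containing \<open>nabla X Z\<close> agree and cancel, so what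
  remains depends on \<open>Z\<close> only through its value at \<open>p\<close>.\<close>

lemma tan_part_parallel:
  assumes X: "smooth_vf A UNIV X" and Y: "smooth_vf A UNIV Y"
  shows "nabla X (\<lambda>q. T q (Y q)) p = T p (nabla X Y p)"
proof (rule M.form_nondegenerate[OF form_h h_pos])
  have nt: "nabla X Z p \<in> tspace A p" if "smooth_vf A UNIV Z" for Z
    using M.smooth_vf_tspace[OF M.connection_smooth[OF connection open_UNIV X that]] by simp
  have Xt: "Y p \<in> tspace A p" using M.smooth_vf_tspace[OF Y] by simp
  note TY = smooth_vf_tan_part[OF Y]
  show "nabla X (\<lambda>q. T q (Y q)) p \<in> tspace A p" by (rule nt[OF TY])
  show "T p (nabla X Y p) \<in> tspace A p" by (rule tan_part_tspace[OF nt[OF Y]])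
  fix z assume z: "z \<in> tspace A p"
  obtain Z where Z: "smooth_vf A UNIV Z" "Z p = z" by (rule M.global_field_extension[OF z])
  have cov: "cov_along A B F nablab p (X p) (\<lambda>q. dF q (V q)) = dF p (nabla X V p)"
    if "smooth_vf A UNIV V" for V
    using totally_geodesic X that by (simp add: totally_geodesic_def second_fundamental_form_def)
  have covt: "cov_along A B F nablab p (X p) (\<lambda>q. dF q (V q)) \<in> tspace B (F p)"
    if "smooth_vf A UNIV V" for V
    by (simp add: cov[OF that] differential_in_tspace)
  \<comment> \<open>Parallelism of the Kaehler form: metric compatibility applied to
    \<open>\<phi> Y\<close>, with \<phi> pulled out of the covariant derivative by the Kaehler
    condition.\<close>
  have par: "dirderiv B p (X p) (\<lambda>q. g q (\<phi> q (Y q)) (Z q)) =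
      g p (\<phi> p (nablab X Y p)) (Z p) + g p (\<phi> p (Y p)) (nablab X Z p)"
    if "open U" "smooth_vf B U X" "smooth_vf B U Y" "smooth_vf B U Z" "p \<in> U" for U X Y Z p
  proof -
    have "nablab X (\<lambda>q. \<phi> q (Y q)) p = \<phi> p (nablab X Y p)"
      using kaehler that unfolding kaehler_def by auto
    then show ?thesis
      using N.levi_civita_metric[OF levi_civita_ambient that(1,2) phi_smooth[OF that(1,3)] that(4,5)]
      by simp
  qed
  have "dirderiv A p (X p) (\<lambda>q. \<omega> q (Y q) (Z q)) =
      \<omega> p (nabla X Y p) (Z p) + \<omega> p (Y p) (nabla X Z p)"
    using dirderiv_parallel_form[OF form_kaehler connection_ambient par Y Z(1) covt[OF Y] covt[OF Z(1)]]
    by (simp add: cov Y Z(1) \<omega>_def)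
  moreover have "(\<lambda>q. \<omega> q (Y q) (Z q)) = (\<lambda>q. h q (T q (Y q)) (Z q))"
    using M.smooth_vf_tspace[OF Y] M.smooth_vf_tspace[OF Z(1)] by (simp add: tan_part)
  moreover have "dirderiv A p (X p) (\<lambda>q. h q (T q (Y q)) (Z q)) =
      h p (nabla X (\<lambda>q. T q (Y q)) p) (Z p) + h p (T p (Y p)) (nabla X Z p)"
    by (rule M.levi_civita_metric[OF levi_civita open_UNIV X TY Z(1) UNIV_I])
  ultimately show "h p (nabla X (\<lambda>q. T q (Y q)) p) z = h p (T p (nabla X Y p)) z"
    using Z(2) Xt z by (simp add: tan_part nt Y Z(1))
qed

end

section \<open>Pointwise slant distributions\<close>

locale totally_geodesic_slant_submanifold = totally_geodesic_submanifold A B F \<phi> g nablab nabla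
  for A :: "('m::{t2_space,second_countable_topology}, 'e::euclidean_space) atlas"
    and B :: "('n::{t2_space,second_countable_topology}, 'f::euclidean_space) atlas"
    and F :: "'m \<Rightarrow> 'n" and \<phi> g nablab nabla +
  fixes k :: nat and D :: "nat \<Rightarrow> ('m, 'e) distribution" and \<theta> :: "nat \<Rightarrow> 'm \<Rightarrow> real"
  assumes slant: "pointwise_k_slant A B F \<phi> g k D \<theta>"
begin

section \<open>The orthogonal summands and their slant functions\<close>

lemma D_orthogonal: "i \<le> k \<Longrightarrow> j \<le> k \<Longrightarrow> i \<noteq> j \<Longrightarrow> u \<in> D i p \<Longrightarrow> v \<in> D j p \<Longrightarrow> h p u v = 0"
  using slant unfolding pointwise_k_slant_def by simp

lemma tspace_eq: "tspace A p = span (\<Union>i\<le>k. D i p)"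
  using slant unfolding pointwise_k_slant_def by simp

lemma D_tspace: "i \<le> k \<Longrightarrow> v \<in> D i p \<Longrightarrow> v \<in> tspace A p"
  unfolding tspace_eq by (rule span_base) auto

lemma subspace_D:
  assumes "i \<le> k"
  shows "subspace (D i p)"
proof -
  have "regular_distribution A (D i)"
    using slant assms unfolding pointwise_k_slant_def by simp
  then obtain S where "span S = D i p"
    unfolding regular_distribution_def by metis
  then show ?thesis by (metis subspace_span)
qed

lemma theta_0: "\<theta> 0 p = 0"
  using slant unfolding pointwise_k_slant_def by simp

lemma theta_range: "i \<in> {1..k} \<Longrightarrow> 0 < \<theta> i p \<and> \<theta> i p \<le> pi / 2"
  using slant unfolding pointwise_k_slant_def by blast

text \<open>On \<open>D 0\<close> the vector \<open>\<phi> (dF v)\<close> is already tangent, so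
  taking the tangential part changes nothing.\<close>

lemma tan_part_invariant:
  assumes v: "v \<in> D 0 p"
  shows "dF p (T p v) = \<phi> (F p) (dF p v)" and "T p v \<in> D 0 p"
proof -
  have "\<phi> (F p) ` dF p ` D 0 p \<subseteq> dF p ` D 0 p"
    using slant unfolding pointwise_k_slant_def by blast
  with v obtain w where w: "w \<in> D 0 p" "\<phi> (F p) (dF p v) = dF p w" by blast
  have "T p v = w"
    using v w D_tspace[of 0] by (intro tan_part_unique) (auto simp: \<omega>_def induced_metric_def)
  with w show "dF p (T p v) = \<phi> (F p) (dF p v)" "T p v \<in> D 0 p" by auto
qed

lemma tan_part_D:
  assumes "i \<le> k" "v \<in> D i p"
  shows "T p v \<in> D i p"
proof (cases "i = 0")
  case True
  with assms show ?thesis using tan_part_invariant by simp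
next
  case False
  with assms show ?thesis using slant unfolding pointwise_k_slant_def by simp
qed

text \<open>Pythagoras: the difference of the two sides is the squared length of the normal part of
  \<open>\<phi> (dF v)\<close>. The bound keeps the argument of \<open>arccos\<close> in the slant
  angle at most 1.\<close>

lemma h_tan_part_le:
  assumes "v \<in> tspace A p"
  shows "h p (T p v) (T p v) \<le> h p v v"
proof -
  let ?u = "\<phi> (F p) (dF p v)" and ?t = "dF p (T p v)"
  have u: "?u \<in> tspace B (F p)" and t: "?t \<in> tspace B (F p)"
    by (simp_all add: phi_tspace differential_in_tspace)
  have "0 \<le> g (F p) (?u - ?t) (?u - ?t)"
    using g_pos[of "?u - ?t" "F p"] N.form_zero_left[OF form_g, of 0 "F p"] N.tspace_diff[OF u t]
    by (cases "?u - ?t = 0") (auto simp: N.tspace_0)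
  also have "\<dots> = g (F p) ?u ?u - 2 * g (F p) ?u ?t + g (F p) ?t ?t"
    by (simp add: N.form_diff_left[OF form_g] N.form_diff_right[OF form_g] N.tspace_diff u t g_sym[OF t u])
  also have "g (F p) ?u ?u = h p v v"
    by (simp add: g_phi_phi differential_in_tspace induced_metric_def)
  also have "g (F p) ?u ?t = h p (T p v) (T p v)"
    using h_tan_part[OF assms tan_part_tspace[OF assms]] by (simp add: \<omega>_def)
  also have "g (F p) ?t ?t = h p (T p v) (T p v)"
    by (simp add: induced_metric_def)
  finally show ?thesis by simp
qed

text \<open>The slant angle projects onto \<open>D i\<close>, whereas \<open>T\<close> projects onto
  the whole tangent space. They agree because \<open>T\<close> preserves \<open>D i\<close> and the
  remainder is normal to the submanifold, hence to \<open>D i\<close>.\<close>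

lemma orth_proj_slant:
  assumes i: "i \<le> k" and v: "v \<in> D i p"
  shows "orth_proj g (F p) (dF p ` D i p) (\<phi> (F p) (dF p v)) = dF p (T p v)"
  unfolding orth_proj_def
proof (rule the_equality)
  have vt: "v \<in> tspace A p" by (rule D_tspace[OF i v])
  have diff: "g (F p) (\<phi> (F p) (dF p v) - dF p w) (dF p z) = h p (T p v - w) z"
    if "w \<in> D i p" "z \<in> D i p" for w z
  proof -
    have "g (F p) (\<phi> (F p) (dF p v) - dF p w) (dF p z) = \<omega> p v z - h p w z"
      by (subst N.form_diff_left[OF form_g])
        (simp_all add: phi_tspace differential_in_tspace induced_metric_def \<omega>_def)
    then show ?thesis
      using D_tspace[OF i that(1)] D_tspace[OF i that(2)] vt
      by (simp add: M.form_diff_left[OF form_h] tan_part)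
  qed
  have Tv: "T p v \<in> D i p" by (rule tan_part_D[OF i v])
  show "dF p (T p v) \<in> dF p ` D i p \<and>
      (\<forall>z\<in>dF p ` D i p. g (F p) (\<phi> (F p) (dF p v) - dF p (T p v)) z = 0)"
    using Tv diff[OF Tv] D_tspace[OF i] by (auto simp: M.form_zero_left[OF form_h])
  fix w assume "w \<in> dF p ` D i p \<and> (\<forall>z\<in>dF p ` D i p. g (F p) (\<phi> (F p) (dF p v) - w) z = 0)"
  then obtain w' where w': "w = dF p w'" "w' \<in> D i p" "\<And>z. z \<in> D i p \<Longrightarrow> h p (T p v - w') z = 0"
    using diff by auto
  have "T p v - w' \<in> D i p" using Tv w'(2) by (rule subspace_diff[OF subspace_D[OF i]])
  then have "T p v - w' = 0"
    using w'(3) h_pos[of "T p v - w'" p] D_tspace[OF i] by fastforce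
  then show "w = dF p (T p v)" using w'(1) by simp
qed

text \<open>By definition \<open>\<theta> i p\<close> is the arccosine of the length ratio of
  \<open>T p v\<close> and \<open>v\<close>. For \<open>i = 0\<close> the ratio is 1 because \<phi>
  is an isometry; \<open>v = 0\<close> has no angle and is treated apart.\<close>

lemma h_tan_part_tan_part:
  assumes i: "i \<le> k" and v: "v \<in> D i p"
  shows "h p (T p v) (T p v) = (cos (\<theta> i p))\<^sup>2 * h p v v"
proof (cases "i = 0 \<or> v = 0")
  case True
  moreover have "h p (T p v) (T p v) = h p v v" if "i = 0"
    using tan_part_invariant(1)[of v p] v that
    by (simp add: induced_metric_def g_phi_phi differential_in_tspace)
  ultimately show ?thesis
    by (auto simp: theta_0 tan_part_0 M.form_zero_left[OF form_h] M.tspace_0)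
next
  case False
  have vt: "v \<in> tspace A p" by (rule D_tspace[OF i v])
  have pos: "0 < h p v v" using h_pos[OF vt] False by simp
  have nn: "0 \<le> h p (T p v) (T p v)" by (rule h_nonneg[OF tan_part_tspace[OF vt]])
  have le: "h p (T p v) (T p v) \<le> h p v v" by (rule h_tan_part_le[OF vt])
  let ?x = "sqrt (h p (T p v) (T p v)) / sqrt (h p v v)"
  have "pointwise_slant A B F \<phi> g (D i) (\<theta> i)"
    using slant i False unfolding pointwise_k_slant_def by simp
  then have "angle_subspace g (F p) (\<phi> (F p) (dF p v)) (dF p ` D i p) = \<theta> i p"
    using v False unfolding pointwise_slant_def by simp
  then have "arccos ?x = \<theta> i p"
    unfolding angle_subspace_def orth_proj_slant[OF i v]
    by (simp add: g_phi_phi differential_in_tspace induced_metric_def)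
  moreover have "0 \<le> ?x" "?x \<le> 1" using pos nn le by auto
  ultimately have "cos (\<theta> i p) = ?x" by (metis cos_arccos neg_le_0_iff_le order_trans zero_le_one)
  then show ?thesis using pos nn by (simp add: power_divide)
qed

section \<open>Recognising a summand through \<open>T\<close>\<close>

lemma D_decomposition:
  assumes "W \<in> tspace A p"
  shows "\<exists>Z. (\<forall>i\<le>k. Z i \<in> D i p) \<and> W = (\<Sum>i\<le>k. Z i)"
proof -
  let ?S = "{\<Sum>i\<le>k. Z i |Z. \<forall>i\<le>k. Z i \<in> D i p}"
  have "subspace ?S"
    unfolding subspace_def
  proof (intro conjI ballI allI)
    show "0 \<in> ?S"
      using subspace_0[OF subspace_D] by (intro CollectI exI[of _ "\<lambda>_. 0"]) simp
  next
    fix x y assume "x \<in> ?S" "y \<in> ?S"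
    then obtain Z Z' where "x = (\<Sum>i\<le>k. Z i)" "y = (\<Sum>i\<le>k. Z' i)" "\<forall>i\<le>k. Z i \<in> D i p" "\<forall>i\<le>k. Z' i \<in> D i p"
      by blast
    then show "x + y \<in> ?S"
      by (intro CollectI exI[of _ "\<lambda>i. Z i + Z' i"]) (simp add: sum.distrib subspace_add[OF subspace_D])
  next
    fix x and a :: real assume "x \<in> ?S"
    then obtain Z where "x = (\<Sum>i\<le>k. Z i)" "\<forall>i\<le>k. Z i \<in> D i p" by blast
    then show "a *\<^sub>R x \<in> ?S"
      by (intro CollectI exI[of _ "\<lambda>i. a *\<^sub>R Z i"])
        (simp add: scaleR_sum_right subspace_scale[OF subspace_D])
  qed
  moreover have "(\<Union>i\<le>k. D i p) \<subseteq> ?S"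
  proof
    fix x assume "x \<in> (\<Union>i\<le>k. D i p)"
    then obtain i where "i \<le> k" "x \<in> D i p" by auto
    then show "x \<in> ?S"
      by (intro CollectI exI[of _ "\<lambda>j. if j = i then x else 0"])
        (simp add: subspace_0[OF subspace_D] sum.delta)
  qed
  ultimately have "span (\<Union>i\<le>k. D i p) \<subseteq> ?S" by (rule span_minimal[rotated])
  with assms show ?thesis unfolding tspace_eq by blast
qed

lemma h_sum_component:
  assumes "\<And>i. i \<le> k \<Longrightarrow> Z i \<in> D i p" "j \<le> k" "z \<in> D j p"
  shows "h p (\<Sum>i\<le>k. Z i) z = h p (Z j) z"
proof -
  have "h p (\<Sum>i\<le>k. Z i) z = (\<Sum>i\<le>k. h p (Z i) z)"
    by (rule M.form_sum_left[OF form_h]) (use assms D_tspace in auto)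
  also have "\<dots> = (\<Sum>i\<le>k. if i = j then h p (Z i) z else 0)"
    by (rule sum.cong) (use assms D_orthogonal in auto)
  finally show ?thesis using assms(2) by simp
qed

lemma sum_in_D:
  assumes "\<And>j. j \<le> k \<Longrightarrow> Z j \<in> D j p" "i \<le> k" "\<And>j. j \<le> k \<Longrightarrow> j \<noteq> i \<Longrightarrow> Z j = 0"
  shows "(\<Sum>j\<le>k. Z j) \<in> D i p"
proof -
  have "(\<Sum>j\<le>k. Z j) = (\<Sum>j\<le>k. if j = i then Z i else 0)"
    by (rule sum.cong) (use assms(3) in auto)
  with assms(1,2) show ?thesis by simp
qed

text \<open>If a component \<open>Z j\<close> with \<open>j > 0\<close> were nonzero, pairing
  \<open>T (T W) = - W\<close> with it would give \<open>(cos (\<theta> j p))\<^sup>2 = 1\<close> by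
  skewness, which is impossible for an angle in \<open>(0, pi/2]\<close>.\<close>

lemma in_D_0_if_tan_part_tan_part:
  assumes W: "W \<in> tspace A p" and TT: "T p (T p W) = - W"
  shows "W \<in> D 0 p"
proof -
  obtain Z where Z: "\<And>i. i \<le> k \<Longrightarrow> Z i \<in> D i p" "W = (\<Sum>i\<le>k. Z i)"
    using D_decomposition[OF W] by blast
  have Zt: "Z i \<in> tspace A p" if "i \<le> k" for i using D_tspace Z(1) that by blast
  have TZ: "T p (Z i) \<in> D i p" if "i \<le> k" for i using tan_part_D Z(1) that by blast
  have "T p W = (\<Sum>i\<le>k. T p (Z i))"
    unfolding Z(2) by (rule tan_part_sum) (simp add: Zt)
  moreover have "T p (\<Sum>i\<le>k. T p (Z i)) = (\<Sum>i\<le>k. T p (T p (Z i)))"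
    by (rule tan_part_sum) (simp add: Zt tan_part_tspace)
  ultimately have TTW: "T p (T p W) = (\<Sum>i\<le>k. T p (T p (Z i)))" by simp
  have "Z j = 0" if j: "j \<le> k" "j \<noteq> 0" for j
  proof (rule ccontr)
    assume "Z j \<noteq> 0"
    then have pos: "0 < h p (Z j) (Z j)" using h_pos Zt j by blast
    have "- h p (Z j) (Z j) = - h p W (Z j)"
      using h_sum_component[OF Z(1) j(1) Z(1)[OF j(1)]] by (simp add: Z(2))
    also have "\<dots> = h p ((- 1) *\<^sub>R W) (Z j)"
      using M.form_scale_left[OF form_h W Zt[OF j(1)], of "- 1"] by simp
    also have "\<dots> = h p (T p (T p (Z j))) (Z j)"
      using h_sum_component[OF tan_part_D[OF _ TZ] j(1) Z(1)[OF j(1)]] TTW TT by simp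
    also have "\<dots> = - (cos (\<theta> j p))\<^sup>2 * h p (Z j) (Z j)"
      using tan_part_skew[OF tan_part_tspace[OF Zt[OF j(1)]] Zt[OF j(1)]]
        h_tan_part_tan_part[OF j(1) Z(1)[OF j(1)]] by simp
    finally have "(cos (\<theta> j p))\<^sup>2 = 1" using pos by simp
    then have "sin (\<theta> j p) = 0" using sin_cos_squared_add[of "\<theta> j p"] by simp
    moreover have "0 < sin (\<theta> j p)"
      using theta_range[of j p] j pi_gt_zero by (intro sin_gt_zero) auto
    ultimately show False by simp
  qed
  then show ?thesis using sum_in_D[of Z p 0] Z by simp
qed

text \<open>The component of \<open>T W\<close> in \<open>D j\<close> is \<open>T (Z j)\<close>. It
  vanishes when \<open>T W\<close> lies in another summand, and \<open>T\<close> multiplies lengths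
  in \<open>D j\<close> by a nonzero cosine, so \<open>Z j\<close> vanishes too.\<close>

lemma in_D_if_tan_part:
  assumes W: "W \<in> tspace A p" and i: "i \<le> k" and TW: "T p W \<in> D i p"
    and \<theta>: "\<And>j. j \<le> k \<Longrightarrow> j \<noteq> i \<Longrightarrow> \<theta> j p \<noteq> pi / 2"
  shows "W \<in> D i p"
proof -
  obtain Z where Z: "\<And>i. i \<le> k \<Longrightarrow> Z i \<in> D i p" "W = (\<Sum>i\<le>k. Z i)"
    using D_decomposition[OF W] by blast
  have Zt: "Z i \<in> tspace A p" if "i \<le> k" for i using D_tspace Z(1) that by blast
  have TZ: "T p (Z i) \<in> D i p" if "i \<le> k" for i using tan_part_D Z(1) that by blast
  have TWsum: "T p W = (\<Sum>i\<le>k. T p (Z i))"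
    unfolding Z(2) by (rule tan_part_sum) (simp add: Zt)
  have "Z j = 0" if j: "j \<le> k" "j \<noteq> i" for j
  proof (rule ccontr)
    assume "Z j \<noteq> 0"
    then have pos: "0 < h p (Z j) (Z j)" using h_pos Zt j by blast
    have "(cos (\<theta> j p))\<^sup>2 * h p (Z j) (Z j) = h p (T p (Z j)) (T p (Z j))"
      using h_tan_part_tan_part[OF j(1) Z(1)[OF j(1)]] by simp
    also have "\<dots> = h p (T p W) (T p (Z j))"
      using h_sum_component[OF TZ j(1) TZ[OF j(1)]] TWsum by simp
    also have "\<dots> = 0" using D_orthogonal[OF i j(1) _ TW TZ[OF j(1)]] j(2) by simp
    finally have "cos (\<theta> j p) = 0" using pos by simp
    moreover have "0 < cos (\<theta> j p)"
    proof (rule cos_gt_zero_pi)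
      \<comment> \<open>The index 0 may occur here, since \<open>i\<close> need not be 0; it is
        covered by the convention that \<open>\<theta> 0\<close> is 0, not by the range of the slant
        functions.\<close>
      have "0 \<le> \<theta> j p \<and> \<theta> j p \<le> pi / 2"
        using theta_range[of j p] theta_0[of p] j pi_gt_zero by (cases "j = 0") auto
      then show "- (pi / 2) < \<theta> j p" "\<theta> j p < pi / 2" using \<theta>[OF j] pi_gt_zero by linarith+
    qed
    ultimately show False by simp
  qed
  then show ?thesis using sum_in_D[of Z p i] Z i by simp
qed

section \<open>Covariant derivatives and Lie brackets of sections\<close>

lemma nabla_smooth: "smooth_vf A UNIV X \<Longrightarrow> smooth_vf A UNIV Y \<Longrightarrow> smooth_vf A UNIV (nabla X Y)"
  by (rule M.connection_smooth[OF connection open_UNIV])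

lemma nabla_tspace: "smooth_vf A UNIV X \<Longrightarrow> smooth_vf A UNIV Y \<Longrightarrow> nabla X Y p \<in> tspace A p"
  using M.smooth_vf_tspace[OF nabla_smooth] by simp

lemma lie_bracket_eq:
  "smooth_vf A UNIV X \<Longrightarrow> smooth_vf A UNIV Y \<Longrightarrow> lie_bracket A X Y = (\<lambda>p. nabla X Y p - nabla Y X p)"
  using M.levi_civita_torsion_free[OF levi_civita open_UNIV] by auto

lemma lie_bracket_smooth:
  "smooth_vf A UNIV X \<Longrightarrow> smooth_vf A UNIV Y \<Longrightarrow> smooth_vf A UNIV (lie_bracket A X Y)"
  by (simp add: lie_bracket_eq M.smooth_vf_diff nabla_smooth)

lemma tan_part_lie_bracket:
  assumes "smooth_vf A UNIV X" "smooth_vf A UNIV Y"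
  shows "T p (lie_bracket A X Y p) = nabla X (\<lambda>q. T q (Y q)) p - nabla Y (\<lambda>q. T q (X q)) p"
  using assms by (simp add: lie_bracket_eq tan_part_diff nabla_tspace tan_part_parallel)

text \<open>The field \<open>X\<close> need not be a section: \<open>D 0\<close> is parallel, which
  is more than integrability. On \<open>D 0\<close> the operator \<open>T\<close> is the restriction
  of \<phi>, so \<open>T (T Y) = - Y\<close>, and this equation survives differentiation.\<close>

lemma nabla_D_0:
  assumes X: "smooth_vf A UNIV X" and Y: "Y \<in> sections A (D 0)"
  shows "nabla X Y p \<in> D 0 p"
proof (rule in_D_0_if_tan_part_tan_part)
  have Ys: "smooth_vf A UNIV Y" and YD: "\<And>q. Y q \<in> D 0 q" using Y by (auto simp: sections_def)
  note TY = smooth_vf_tan_part[OF Ys]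
  show "nabla X Y p \<in> tspace A p" by (rule nabla_tspace[OF X Ys])
  have TTY: "T q (T q (Y q)) = (- 1) *\<^sub>R Y q" for q
  proof (rule differential_inject)
    have t: "Y q \<in> tspace A q" by (rule D_tspace[of 0]) (simp_all add: YD)
    show "T q (T q (Y q)) \<in> tspace A q" "(- 1) *\<^sub>R Y q \<in> tspace A q"
      by (intro tan_part_tspace M.tspace_scale t)+
    have "dF q (T q (T q (Y q))) = - dF q (Y q)"
      by (simp add: tan_part_invariant YD phi_phi differential_in_tspace)
    then show "dF q (T q (T q (Y q))) = dF q ((- 1) *\<^sub>R Y q)"
      using linear_cmul[OF linear_differential, of q "- 1" "Y q"] by simp
  qed
  \<comment> \<open>Commuting \<open>T\<close> with the covariant derivative twice applies
    parallelism to \<open>Y\<close> and to \<open>T Y\<close>; the second use needs the smoothness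
    of \<open>T Y\<close>.\<close>
  have "T p (T p (nabla X Y p)) = nabla X (\<lambda>q. T q (T q (Y q))) p"
    by (simp add: tan_part_parallel X Ys TY)
  also have "\<dots> = - nabla X Y p"
    unfolding TTY using M.connection_scale[OF connection open_UNIV X Ys UNIV_I, of "- 1"] by simp
  finally show "T p (T p (nabla X Y p)) = - nabla X Y p" .
qed

lemma integrable_D_0: "integrable_distribution A (D 0)"
  unfolding integrable_distribution_def
proof (intro ballI)
  fix X Y assume XY: "X \<in> sections A (D 0)" "Y \<in> sections A (D 0)"
  then have s: "smooth_vf A UNIV X" "smooth_vf A UNIV Y" by (auto simp: sections_def)
  have "lie_bracket A X Y p \<in> D 0 p" for p
    using s XY by (simp add: lie_bracket_eq subspace_diff[OF subspace_D] nabla_D_0)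
  then show "lie_bracket A X Y \<in> sections A (D 0)"
    using s by (simp add: sections_def lie_bracket_smooth)
qed

text \<open>The equivalence holds for each pair of sections at each point: the bracket lies in
  \<open>D i\<close> if and only if its image under \<open>T\<close> does, by invariance of
  \<open>D i\<close> in one direction and by \<open>in_D_if_tan_part\<close> in the other.\<close>

lemma integrable_D_iff:
  assumes i: "i \<le> k" and \<theta>: "\<And>j p. j \<le> k \<Longrightarrow> j \<noteq> i \<Longrightarrow> \<theta> j p \<noteq> pi / 2"
  shows "integrable_distribution A (D i) \<longleftrightarrow>
    (\<forall>X\<in>sections A (D i). \<forall>Y\<in>sections A (D i).
      (\<lambda>p. nabla X (\<lambda>q. T q (Y q)) p - nabla Y (\<lambda>q. T q (X q)) p) \<in> sections A (D i))"
  unfolding integrable_distribution_def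
proof (intro ball_cong refl)
  fix X Y assume "X \<in> sections A (D i)" "Y \<in> sections A (D i)"
  then have s: "smooth_vf A UNIV X" "smooth_vf A UNIV Y" by (auto simp: sections_def)
  have "smooth_vf A UNIV (\<lambda>p. nabla X (\<lambda>q. T q (Y q)) p - nabla Y (\<lambda>q. T q (X q)) p)"
    by (intro M.smooth_vf_diff nabla_smooth smooth_vf_tan_part s open_UNIV)
  moreover have "lie_bracket A X Y p \<in> D i p \<longleftrightarrow>
      nabla X (\<lambda>q. T q (Y q)) p - nabla Y (\<lambda>q. T q (X q)) p \<in> D i p" for p
    unfolding tan_part_lie_bracket[OF s, symmetric]
    using tan_part_D[OF i] in_D_if_tan_part[OF _ i _ \<theta>]
      M.smooth_vf_tspace[OF lie_bracket_smooth[OF s] UNIV_I]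
    by blast
  ultimately show "lie_bracket A X Y \<in> sections A (D i) \<longleftrightarrow>
      (\<lambda>p. nabla X (\<lambda>q. T q (Y q)) p - nabla Y (\<lambda>q. T q (X q)) p) \<in> sections A (D i)"
    using lie_bracket_smooth[OF s] by (simp add: sections_def)
qed

end

theorem corollary3p2:
  fixes A :: "('m::{t2_space,second_countable_topology}, 'e::euclidean_space) atlas"
    and B :: "('n::{t2_space,second_countable_topology}, 'f::euclidean_space) atlas"
    and F :: "'m \<Rightarrow> 'n"
    and \<phi> :: "('n, 'f) endo"
    and g :: "('n, 'f) metric"
    and nablab :: "('n, 'f) connection"
    and nabla :: "('m, 'e) connection"
    and k :: nat
    and D :: "nat \<Rightarrow> ('m, 'e) distribution"
    and \<theta> :: "nat \<Rightarrow> 'm \<Rightarrow> real"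
  assumes "smooth_atlas B" and "kaehler B \<phi> g nablab"
    and "smooth_atlas A" and "injective_immersion A B F"
    and "levi_civita A (induced_metric A B F g) nabla"
    and "pointwise_k_slant A B F \<phi> g k D \<theta>"
    and "totally_geodesic A B F nablab nabla"
  shows "integrable_distribution A (D 0) \<and>
    (\<forall>i\<le>k. (\<forall>j\<le>k. j \<noteq> i \<longrightarrow> (\<forall>p. \<theta> j p \<noteq> pi / 2)) \<longrightarrow>
       (integrable_distribution A (D i) \<longleftrightarrow>
        (\<forall>X\<in>sections A (D i). \<forall>Y\<in>sections A (D i).
           (\<lambda>p. nabla X (\<lambda>q. tan_part A B F \<phi> g q (Y q)) p -
                nabla Y (\<lambda>q. tan_part A B F \<phi> g q (X q)) p) \<in> sections A (D i))))"
proof -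
  interpret totally_geodesic_slant_submanifold A B F \<phi> g nablab nabla k D \<theta>
    using assms by unfold_locales (auto simp: injective_immersion_def)
  show ?thesis using integrable_D_0 integrable_D_iff by blast
qed

end
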